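(* Let $\varphi\colon P_n(M)\to\mathbb{R}$ be a homogeneous quasimorphism vanishing on the centre of $P_n(M)$ and, if $M$ is a surface, vanishing on $P_n(\Delta)$. Let $f\in\mathrm{Homeo}_0(M)$. If the base-point $z\in C_n(M)$ is a fixed point of $f$ such that $\varphi(\gamma(f,z))>0$, then $f$ is undistorted in $\mathrm{Homeo}_0(M)$.
   Context: $M$ is a smooth compact oriented connected manifold of dimension at least $2$ with a Borel probability measure $\mu$ induced by a volume form. If $\dim M=2$, $n\ge 1$ is an arbitrary integer; if $\dim M\geq 3$, $n=1$. $\mathrm{Homeo}_0(M)$ is the group of homeomorphisms of $M$ which are the identity on a neighbourhood of $\partial M$ and are isotopic to the identity. $C_n(M)\subset M^n$ is the space of ordered configurations of $n$ distinct points, with the product action of $\mathrm{Homeo}_0(M)$. $P_n(M)=\pi_1(C_n(M),z)$ is the pure braid group (so $P_1(M)=\pi_1(M)$). $\Delta\subseteq M$ is the interior of the unique top-dimensional cell in a CW-decomposition of $M$ with one top-dimensional cell; it is diffeomorphic to an open Euclidean ball and has full measure. The base-point $z=(z_1,\dots,z_n)$ has all $z_i\in\Delta$. $P_n(\Delta)\le P_n(M)$ is the image of $\pi_1(C_n(\Delta),z)$ under inclusion. If $f(z)=z$, then $\gamma(f,z)\in P_n(M)$ is the class of the loop $\{f_t(z)\}$, where $\{f_t\}$ is an isotopy in $\mathrm{Homeo}_0(M)$ from the identity to $f$. It is independent of the isotopy up to a central factor, and $\varphi(\gamma(f,z))$ does not depend on the isotopy since $\varphi$ is homogeneous and vanishes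 on the centre. A quasimorphism on a group $G$ is a function $\varphi\colon G\to\mathbb{R}$ with $\sup_{g,h}|\varphi(h)-\varphi(gh)+\varphi(g)|<\infty$; it is homogeneous if $\varphi(g^k)=k\varphi(g)$ for all $g\in G$, $k\in\mathbb{Z}$. An element $g$ of a finitely generated group $\Gamma$ is undistorted if $\lim_{k\to\infty}|g^k|/k>0$, where $|\cdot|$ is the word norm of any finite generating set. An element of an arbitrary group $G$ is undistorted if it is undistorted in every finitely generated subgroup of $G$ containing it. *)

theory Defs
  imports "HOL-Probability.Probability_Measure" "HOL-Algebra.Generated_Groups"
begin

section \<open>Smooth maps between subsets of Euclidean spaces\<close>

primrec Ck_on :: "nat \<Rightarrow> 'a::euclidean_space set \<Rightarrow> ('a \<Rightarrow> 'b::real_normed_vector) \<Rightarrow> bool" where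
  "Ck_on 0 V g \<longleftrightarrow> continuous_on V g"
| "Ck_on (Suc k) V g \<longleftrightarrow>
     (\<forall>x\<in>V. g differentiable (at x)) \<and>
     (\<forall>v. Ck_on k V (\<lambda>x. frechet_derivative g (at x) v))"

text \<open>On a set that is not open (a relatively open subset of a half-space), smoothness means the
  local existence of smooth extensions.\<close>

definition smooth_on :: "'a::euclidean_space set \<Rightarrow> ('a \<Rightarrow> 'b::real_normed_vector) \<Rightarrow> bool" where
  "smooth_on X f \<longleftrightarrow>
     (\<forall>x\<in>X. \<exists>V g. open V \<and> x \<in> V \<and> (\<forall>k. Ck_on k V g) \<and> (\<forall>y\<in>X \<inter> V. g y = f y))"


section \<open>Oriented smooth manifolds with boundary\<close>

text \<open>The manifold is the whole type \<open>'a\<close>; its dimension is \<open>CARD('m)\<close>. Only the restriction of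
  \<open>\<psi>\<close> to \<open>U\<close> is relevant in a chart \<open>(U, \<psi>)\<close>.\<close>

type_synonym ('a, 'm) chart = "'a set \<times> ('a \<Rightarrow> real ^ 'm)"

definition model_open :: "(real ^ 'm::finite) set \<Rightarrow> bool" where
  "model_open W \<longleftrightarrow> open W \<or> (\<exists>i. openin (top_of_set {x. 0 \<le> x $ i}) W)"

definition is_chart :: "('a::topological_space, 'm::finite) chart \<Rightarrow> bool" where
  "is_chart c \<longleftrightarrow> (case c of (U, \<psi>) \<Rightarrow>
     open U \<and> homeomorphism U (\<psi> ` U) \<psi> (inv_into U \<psi>) \<and> model_open (\<psi> ` U))"

definition transition_dom :: "('a, 'm::finite) chart \<Rightarrow> ('a, 'm) chart \<Rightarrow> (real ^ 'm) set" where
  "transition_dom c c' = snd c ` (fst c \<inter> fst c')"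

definition transition :: "('a, 'm::finite) chart \<Rightarrow> ('a, 'm) chart \<Rightarrow> real ^ 'm \<Rightarrow> real ^ 'm" where
  "transition c c' = snd c' \<circ> inv_into (fst c) (snd c)"

text \<open>The derivative is taken within the domain of the transition map, so that it also makes
  sense (and is unique) at boundary points.\<close>

definition transition_jacobian ::
    "('a, 'm::finite) chart \<Rightarrow> ('a, 'm) chart \<Rightarrow> real ^ 'm \<Rightarrow> real" where
  "transition_jacobian c c' x =
     det (matrix (frechet_derivative (transition c c') (at x within transition_dom c c')))"

definition oriented_smooth_atlas :: "('a::topological_space, 'm::finite) chart set \<Rightarrow> bool" where
  "oriented_smooth_atlas A \<longleftrightarrow>
     (\<forall>c\<in>A. is_chart c) \<and>
     (\<Union>c\<in>A. fst c) = UNIV \<and>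
     (\<forall>c\<in>A. \<forall>c'\<in>A. smooth_on (transition_dom c c') (transition c c') \<and>
        (\<forall>x\<in>transition_dom c c'. transition_jacobian c c' x > 0))"

text \<open>A boundary point is one whose chart image is not an interior point of the image of the chart
  domain; by invariance of domain this does not depend on the chart.\<close>

definition mfd_boundary :: "('a::topological_space, 'm::finite) chart set \<Rightarrow> 'a set" where
  "mfd_boundary A = {x. \<exists>(U, \<psi>)\<in>A. x \<in> U \<and> \<psi> x \<notin> interior (\<psi> ` U)}"

text \<open>A positively oriented volume form is given by its positive smooth coefficient functions
  \<open>\<rho> c\<close> in the charts (the form is \<open>\<rho> c dx\<^sub>1 \<and> \<dots> \<and> dx\<^sub>m\<close> in the chart \<open>c\<close>), subject to the
  transformation rule of forms of top degree.\<close>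

definition volume_form ::
    "('a::topological_space, 'm::finite) chart set \<Rightarrow> (('a, 'm) chart \<Rightarrow> real ^ 'm \<Rightarrow> real) \<Rightarrow> bool"
  where
  "volume_form A \<rho> \<longleftrightarrow>
     (\<forall>c\<in>A. smooth_on (snd c ` fst c) (\<rho> c) \<and> (\<forall>x\<in>snd c ` fst c. \<rho> c x > 0)) \<and>
     (\<forall>c\<in>A. \<forall>c'\<in>A. \<forall>x\<in>transition_dom c c'.
        \<rho> c x = \<rho> c' (transition c c' x) * transition_jacobian c c' x)"

definition induced_by_volume_form ::
    "('a::topological_space, 'm::finite) chart set \<Rightarrow> 'a measure \<Rightarrow> bool" where
  "induced_by_volume_form A \<mu> \<longleftrightarrow>
     sets \<mu> = sets borel \<and>
     (\<exists>\<rho>. volume_form A \<rho> \<and>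
        (\<forall>c\<in>A. \<forall>B\<in>sets borel. B \<subseteq> fst c \<longrightarrow>
           emeasure \<mu> B = (\<integral>\<^sup>+x\<in>snd c ` B. ennreal (\<rho> c x) \<partial>lborel)))"

definition diffeomorphic_to_open_ball ::
    "('a::topological_space, 'm::finite) chart set \<Rightarrow> 'a set \<Rightarrow> bool" where
  "diffeomorphic_to_open_ball A D \<longleftrightarrow>
     (\<exists>g h. homeomorphism (ball (0 :: real ^ 'm) 1) D g h \<and>
        (\<forall>(U, \<psi>)\<in>A. smooth_on {x \<in> ball 0 1. g x \<in> U} (\<psi> \<circ> g) \<and>
                    smooth_on (\<psi> ` (U \<inter> D)) (h \<circ> inv_into U \<psi>)))"


section \<open>CW-decompositions\<close>

definition cw_disc :: "nat \<Rightarrow> (nat \<Rightarrow> real) set" where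
  "cw_disc d = {x \<in> topspace (Euclidean_space d). (\<Sum>i<d. (x i)\<^sup>2) \<le> 1}"

definition cw_open_disc :: "nat \<Rightarrow> (nat \<Rightarrow> real) set" where
  "cw_open_disc d = {x \<in> topspace (Euclidean_space d). (\<Sum>i<d. (x i)\<^sup>2) < 1}"

text \<open>A cell is given by its dimension and its characteristic map. The definition is meant for
  compact Hausdorff spaces: there a CW-decomposition has finitely many cells, closure-finiteness
  and the weak topology are automatic, and so is the fact that a characteristic map is a
  homeomorphism from the open disc onto the open cell.\<close>

definition cw_decomposition :: "(nat \<times> ((nat \<Rightarrow> real) \<Rightarrow> 'a::topological_space)) set \<Rightarrow> bool" where
  "cw_decomposition C \<longleftrightarrow>
     finite C \<and>
     (\<Union>(d, \<Phi>)\<in>C. \<Phi> ` cw_open_disc d) = UNIV \<and>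
     (\<forall>(d, \<Phi>)\<in>C. \<forall>(d', \<Phi>')\<in>C. (d, \<Phi>) \<noteq> (d', \<Phi>') \<longrightarrow>
        \<Phi> ` cw_open_disc d \<inter> \<Phi>' ` cw_open_disc d' = {}) \<and>
     (\<forall>(d, \<Phi>)\<in>C. continuous_on (cw_disc d) \<Phi> \<and> inj_on \<Phi> (cw_open_disc d) \<and>
        \<Phi> ` (cw_disc d - cw_open_disc d) \<subseteq> (\<Union>(d', \<Phi>')\<in>{c \<in> C. fst c < d}. \<Phi>' ` cw_open_disc d'))"

text \<open>\<open>D\<close> is the open cell belonging to the only \<open>m\<close>-dimensional cell of a CW-decomposition all of
  whose other cells have dimension less than \<open>m\<close>.\<close>

definition unique_top_cell :: "nat \<Rightarrow> 'a::topological_space set \<Rightarrow> bool" where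
  "unique_top_cell m D \<longleftrightarrow>
     (\<exists>C \<Phi>. cw_decomposition C \<and> (m, \<Phi>) \<in> C \<and> (\<forall>c\<in>C. c \<noteq> (m, \<Phi>) \<longrightarrow> fst c < m) \<and>
        D = \<Phi> ` cw_open_disc m)"


section \<open>The group \<open>Homeo\<^sub>0(M)\<close>\<close>

definition Homeo_rel_boundary :: "('a::topological_space, 'm::finite) chart set \<Rightarrow> ('a \<Rightarrow> 'a) set" where
  "Homeo_rel_boundary A =
     {f. (\<exists>g. homeomorphism UNIV UNIV f g) \<and>
         (\<exists>N. open N \<and> mfd_boundary A \<subseteq> N \<and> (\<forall>x\<in>N. f x = x))}"

text \<open>Every stage of an isotopy is the identity near the boundary. By restricting an isotopy to
  \<open>[0, t]\<close> and rescaling, every stage is itself in \<open>Homeo0 A\<close>.\<close>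

definition isotopy_from_id ::
    "('a::topological_space, 'm::finite) chart set \<Rightarrow> (real \<Rightarrow> 'a \<Rightarrow> 'a) \<Rightarrow> ('a \<Rightarrow> 'a) \<Rightarrow> bool" where
  "isotopy_from_id A H f \<longleftrightarrow>
     continuous_on ({0..1} \<times> UNIV) (\<lambda>(t, x). H t x) \<and>
     (\<forall>t\<in>{0..1}. H t \<in> Homeo_rel_boundary A) \<and> H 0 = id \<and> H 1 = f"

definition Homeo0 :: "('a::topological_space, 'm::finite) chart set \<Rightarrow> ('a \<Rightarrow> 'a) set" where
  "Homeo0 A = {f \<in> Homeo_rel_boundary A. \<exists>H. isotopy_from_id A H f}"

definition Homeo0_group :: "('a::topological_space, 'm::finite) chart set \<Rightarrow> ('a \<Rightarrow> 'a) monoid" where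
  "Homeo0_group A = \<lparr>carrier = Homeo0 A, mult = (\<circ>), one = id\<rparr>"


section \<open>Configuration spaces, fundamental groups and pure braid groups\<close>

definition conf :: "'a set \<Rightarrow> ('a ^ 'n::finite) set" where
  "conf X = {x. (\<forall>i. x $ i \<in> X) \<and> inj (\<lambda>i. x $ i)}"

definition loops_at :: "'b::topological_space set \<Rightarrow> 'b \<Rightarrow> (real \<Rightarrow> 'b) set" where
  "loops_at S z = {p. path p \<and> path_image p \<subseteq> S \<and> pathstart p = z \<and> pathfinish p = z}"

definition loop_class :: "'b::topological_space set \<Rightarrow> (real \<Rightarrow> 'b) \<Rightarrow> (real \<Rightarrow> 'b) set" where
  "loop_class S p = {q. homotopic_paths S p q}"

definition fundamental_group :: "'b::topological_space set \<Rightarrow> 'b \<Rightarrow> (real \<Rightarrow> 'b) set monoid" where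
  "fundamental_group S z =
     \<lparr>carrier = loop_class S ` loops_at S z,
      mult = (\<lambda>X Y. {r. \<exists>p\<in>X. \<exists>q\<in>Y. homotopic_paths S (p +++ q) r}),
      one = loop_class S (\<lambda>_. z)\<rparr>"

definition pure_braid_group :: "('a::topological_space ^ 'n::finite) \<Rightarrow> (real \<Rightarrow> 'a ^ 'n) set monoid"
  where "pure_braid_group z = fundamental_group (conf UNIV) z"

text \<open>The image of \<open>\<pi>\<^sub>1(C\<^sub>n(D), z)\<close> in the pure braid group of the whole manifold.\<close>

definition local_pure_braids ::
    "'a::topological_space set \<Rightarrow> 'a ^ 'n::finite \<Rightarrow> (real \<Rightarrow> 'a ^ 'n) set set" where
  "local_pure_braids D z = loop_class (conf UNIV) ` loops_at (conf D) z"

text \<open>For an isotopy \<open>H\<close> from \<open>id\<close> to a homeomorphism \<open>f\<close> fixing \<open>z\<close>, this is \<open>\<gamma>(f, z)\<close>; it depends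
  on \<open>H\<close> only up to a central factor.\<close>

definition isotopy_braid ::
    "(real \<Rightarrow> 'a \<Rightarrow> 'a) \<Rightarrow> 'a::topological_space ^ 'n::finite \<Rightarrow> (real \<Rightarrow> 'a ^ 'n) set" where
  "isotopy_braid H z = loop_class (conf UNIV) (\<lambda>t. \<chi> i. H t (z $ i))"


section \<open>Group-theoretic notions\<close>

definition group_centre :: "('g, 'r) monoid_scheme \<Rightarrow> 'g set" where
  "group_centre G = {c \<in> carrier G. \<forall>g\<in>carrier G. c \<otimes>\<^bsub>G\<^esub> g = g \<otimes>\<^bsub>G\<^esub> c}"

definition quasimorphism :: "('g, 'r) monoid_scheme \<Rightarrow> ('g \<Rightarrow> real) \<Rightarrow> bool" where
  "quasimorphism G \<phi> \<longleftrightarrow>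
     (\<exists>D. \<forall>g\<in>carrier G. \<forall>h\<in>carrier G. \<bar>\<phi> h - \<phi> (g \<otimes>\<^bsub>G\<^esub> h) + \<phi> g\<bar> \<le> D)"

definition homogeneous_on :: "('g, 'r) monoid_scheme \<Rightarrow> ('g \<Rightarrow> real) \<Rightarrow> bool" where
  "homogeneous_on G \<phi> \<longleftrightarrow>
     (\<forall>g\<in>carrier G. \<forall>k::int. \<phi> (g [^]\<^bsub>G\<^esub> k) = of_int k * \<phi> g)"

definition finite_generating_set :: "('g, 'r) monoid_scheme \<Rightarrow> 'g set \<Rightarrow> bool" where
  "finite_generating_set G S \<longleftrightarrow> finite S \<and> S \<subseteq> carrier G \<and> generate G S = carrier G"

definition word_norm :: "('g, 'r) monoid_scheme \<Rightarrow> 'g set \<Rightarrow> 'g \<Rightarrow> nat" where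
  "word_norm G S g =
     (LEAST l. \<exists>ws. length ws = l \<and> set ws \<subseteq> S \<union> m_inv G ` S \<and> foldr (mult G) ws \<one>\<^bsub>G\<^esub> = g)"

definition undistorted_fg :: "('g, 'r) monoid_scheme \<Rightarrow> 'g \<Rightarrow> bool" where
  "undistorted_fg G g \<longleftrightarrow>
     (\<forall>S. finite_generating_set G S \<longrightarrow>
        (\<exists>L>0. (\<lambda>k::nat. real (word_norm G S (g [^]\<^bsub>G\<^esub> k)) / real k) \<longlonglongrightarrow> L))"

definition undistorted :: "('g, 'r) monoid_scheme \<Rightarrow> 'g \<Rightarrow> bool" where
  "undistorted G g \<longleftrightarrow>
     g \<in> carrier G \<and>
     (\<forall>\<Gamma>. subgroup \<Gamma> G \<and> g \<in> \<Gamma> \<and> (\<exists>S. finite_generating_set (G\<lparr>carrier := \<Gamma>\<rparr>) S) \<longrightarrow>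
        undistorted_fg (G\<lparr>carrier := \<Gamma>\<rparr>) g)"

end

theory Submission
  imports Defs
begin

text \<open>
  Conjugating by chosen elements \<open>\<tau> x\<close> turns the trace of a configuration \<open>x\<close> under an isotopy into an
  element of the pure braid group, also when the trace is not closed. The heart of the matter is that \<open>\<tau>\<close> can be chosen
  such that, for each isotopy, \<open>\<phi>\<close> is bounded on these elements uniformly in \<open>x\<close>, although the
  configuration space is not compact. Its compactification, the product of \<open>n\<close> copies of \<open>M\<close>,
  is covered by finitely many products of chart cells that are pairwise equal or disjoint. Within
  such a product the configurations form a path-connected set, and \<open>\<phi>\<close> vanishes on its loops: scaling
  the cells in their charts moves a loop into \<open>\<Delta>\<close>, which is open and dense, so the loop is conjugate to
  a local braid. Now write \<open>f ^^ k\<close> as a word of length \<open>l\<close> in a finite generating set. The trace of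
  \<open>z\<close> is a concatenation of \<open>l\<close> traces, so \<open>\<phi>\<close> is at most linear in \<open>l\<close>. Up to a central factor,
  on which \<open>\<phi>\<close> vanishes, it is also the \<open>k\<close>-th power of the braid of \<open>f\<close>, so it has value
  \<open>k * \<phi> (isotopy_braid H z)\<close> up to the defect. Hence the word norm of \<open>f ^^ k\<close> grows linearly in \<open>k\<close>.
\<close>

section \<open>The fundamental group\<close>

text \<open>The obstacle is the diagonal: points that come close may wind around each other
  arbitrarily often, so the traces of an isotopy need not represent finitely many braids and no
  bound on braid length is available. The bound comes from \<open>\<phi>\<close> itself. Cell
  products are neighbourhoods of all points of the compact product, diagonal included, and loops
  inside one of them are invisible to \<open>\<phi>\<close>; what remains is how a path passes
  between members of a finite cover, and this leaves finitely many cases. An isotopy acts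
  continuously on the whole product and preserves the configurations, so compactness in time and
  space applies to its traces. The measure supplies the density of \<open>\<Delta>\<close>: each
  cell must contain a point of \<open>\<Delta>\<close> towards which to shrink. On loops in
  \<open>\<Delta>\<close> the vanishing is the hypothesis for surfaces; in higher dimension there is
  one point, and its loops in a ball contract. Undistortedness also asserts that a limit exists;
  this follows from subadditivity of the word norm, and the quasimorphism shows that the limit is
  positive.\<close>

lemma homotopic_paths_compose_convex:
  fixes a b :: "real \<Rightarrow> 'c::real_normed_vector"
  assumes "convex T" "continuous_on T Q" "Q ` T \<subseteq> S"
    and "path a" "path_image a \<subseteq> T" "path b" "path_image b \<subseteq> T"
    and "pathstart a = pathstart b" "pathfinish a = pathfinish b"
  shows "homotopic_paths S (Q \<circ> a) (Q \<circ> b)"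
proof -
  have "homotopic_paths T a b"
    using convex_imp_simply_connected[OF assms(1)] assms
    unfolding simply_connected_eq_homotopic_paths by simp
  then show ?thesis
    by (rule homotopic_paths_continuous_image) (use assms in auto)
qed

text \<open>An interval is convex, so paths in it with common ends are homotopic. The unit and
  inverse laws below follow by writing constant and reversed paths as \<open>p\<close> run along a
  \<open>linepath\<close> in the interval.\<close>

lemma homotopic_paths_reparam:
  assumes "path p" "path_image p \<subseteq> S"
    and "path a" "path_image a \<subseteq> {0..1}" "path b" "path_image b \<subseteq> {0..1}"
    and "pathstart a = pathstart b" "pathfinish a = pathfinish b"
  shows "homotopic_paths S (p \<circ> a) (p \<circ> b)"
  by (rule homotopic_paths_compose_convex[where T = "{0..1}"])
    (use assms in \<open>auto simp: path_def path_image_def\<close>)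

lemma path_comp_id_linepath: "p \<circ> linepath 0 (1::real) = p"
  by (auto simp: linepath_def fun_eq_iff)

lemma path_comp_linepath_const: "p \<circ> linepath (a::real) a = (\<lambda>_. p a)"
  by (auto simp: linepath_def fun_eq_iff algebra_simps)

lemma path_const [simp]: "path (\<lambda>_. x)"
  by (simp add: path_def)

lemma path_image_const [simp]: "path_image (\<lambda>_. x) = {x}"
  by (auto simp: path_image_def)

lemma pathstart_const [simp]: "pathstart (\<lambda>_. x) = x"
  by (simp add: pathstart_def)

lemma pathfinish_const [simp]: "pathfinish (\<lambda>_. x) = x"
  by (simp add: pathfinish_def)

lemma reversepath_eq_compose: "reversepath p = p \<circ> linepath 1 (0::real)"
  by (auto simp: reversepath_def linepath_def fun_eq_iff)

lemma homotopic_paths_join_const: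
  assumes "path p" "path_image p \<subseteq> S"
  shows "homotopic_paths S (p +++ (\<lambda>_. pathfinish p)) p"
proof -
  have "homotopic_paths S (p \<circ> (linepath 0 1 +++ linepath 1 1)) (p \<circ> linepath 0 1)"
    by (rule homotopic_paths_reparam)
      (use assms in \<open>auto simp: path_image_join closed_segment_eq_real_ivl\<close>)
  then show ?thesis
    by (simp add: path_compose_join path_comp_id_linepath path_comp_linepath_const pathfinish_def)
qed

lemma homotopic_paths_const_join:
  assumes "path p" "path_image p \<subseteq> S"
  shows "homotopic_paths S ((\<lambda>_. pathstart p) +++ p) p"
proof -
  have "homotopic_paths S (p \<circ> (linepath 0 0 +++ linepath 0 1)) (p \<circ> linepath 0 1)"
    by (rule homotopic_paths_reparam)
      (use assms in \<open>auto simp: path_image_join closed_segment_eq_real_ivl\<close>)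
  then show ?thesis
    by (simp add: path_compose_join path_comp_id_linepath path_comp_linepath_const pathstart_def)
qed

lemma homotopic_paths_join_reverse:
  assumes "path p" "path_image p \<subseteq> S"
  shows "homotopic_paths S (p +++ reversepath p) (\<lambda>_. pathstart p)"
proof -
  have "homotopic_paths S (p \<circ> (linepath 0 1 +++ linepath 1 0)) (p \<circ> linepath 0 0)"
    by (rule homotopic_paths_reparam)
      (use assms in \<open>auto simp: path_image_join closed_segment_eq_real_ivl\<close>)
  then show ?thesis
    by (simp add: path_compose_join path_comp_id_linepath path_comp_linepath_const pathstart_def
        reversepath_eq_compose)
qed

lemma homotopic_paths_reverse_join:
  assumes "path p" "path_image p \<subseteq> S"
  shows "homotopic_paths S (reversepath p +++ p) (\<lambda>_. pathfinish p)"
  using homotopic_paths_join_reverse[of "reversepath p" S] assms by simp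

lemma loop_class_eq:
  assumes "homotopic_paths S p q"
  shows "loop_class S p = loop_class S q"
  using assms unfolding loop_class_def by (blast intro: homotopic_paths_trans homotopic_paths_sym)

lemma loops_at_join: "p \<in> loops_at S z \<Longrightarrow> q \<in> loops_at S z \<Longrightarrow> p +++ q \<in> loops_at S z"
  by (auto simp: loops_at_def path_image_join)

lemma loops_at_reversepath: "p \<in> loops_at S z \<Longrightarrow> reversepath p \<in> loops_at S z"
  by (auto simp: loops_at_def)

lemma loops_at_const: "z \<in> S \<Longrightarrow> (\<lambda>_. z) \<in> loops_at S z"
  by (auto simp: loops_at_def)

lemma carrier_fundamental_group [simp]:
  "carrier (fundamental_group S z) = loop_class S ` loops_at S z"
  by (simp add: fundamental_group_def)

lemma one_fundamental_group: "\<one>\<^bsub>fundamental_group S z\<^esub> = loop_class S (\<lambda>_. z)"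
  by (simp add: fundamental_group_def)

text \<open>The product is defined through all representatives at once; since \<open>+++\<close>
  respects homotopy, any one pair of representatives suffices.\<close>

lemma mult_fundamental_group:
  assumes "p \<in> loops_at S z" "q \<in> loops_at S z"
  shows "loop_class S p \<otimes>\<^bsub>fundamental_group S z\<^esub> loop_class S q = loop_class S (p +++ q)"
proof -
  have "\<exists>p'\<in>loop_class S p. \<exists>q'\<in>loop_class S q. homotopic_paths S (p' +++ q') r"
    if "homotopic_paths S (p +++ q) r" for r
    using that assms by (intro bexI[of _ p] bexI[of _ q]) (auto simp: loop_class_def loops_at_def)
  moreover have "homotopic_paths S (p +++ q) r"
    if "homotopic_paths S p p'" "homotopic_paths S q q'" "homotopic_paths S (p' +++ q') r" for p' q' r
    using that assms homotopic_paths_join[OF that(1,2)] unfolding loops_at_def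
    by (auto intro: homotopic_paths_trans)
  ultimately show ?thesis
    by (fastforce simp: fundamental_group_def loop_class_def)
qed

lemma group_fundamental_group:
  assumes "z \<in> S"
  shows "group (fundamental_group S z)"
proof (rule groupI)
  let ?G = "fundamental_group S z"
  note c = loops_at_join loops_at_reversepath loops_at_const[OF assms]
  show "\<one>\<^bsub>?G\<^esub> \<in> carrier ?G" using c by (auto simp: one_fundamental_group)
  show "x \<otimes>\<^bsub>?G\<^esub> y \<in> carrier ?G" if "x \<in> carrier ?G" "y \<in> carrier ?G" for x y
    using that c by (force simp: mult_fundamental_group)
  show "x \<otimes>\<^bsub>?G\<^esub> y \<otimes>\<^bsub>?G\<^esub> w = x \<otimes>\<^bsub>?G\<^esub> (y \<otimes>\<^bsub>?G\<^esub> w)"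
    if xyw: "x \<in> carrier ?G" "y \<in> carrier ?G" "w \<in> carrier ?G" for x y w
  proof -
    obtain p q r where *: "x = loop_class S p" "y = loop_class S q" "w = loop_class S r"
      "p \<in> loops_at S z" "q \<in> loops_at S z" "r \<in> loops_at S z"
      using xyw unfolding carrier_fundamental_group by blast
    then have "homotopic_paths S (p +++ (q +++ r)) ((p +++ q) +++ r)"
      by (intro homotopic_paths_assoc) (auto simp: loops_at_def)
    then show ?thesis
      using * by (simp add: mult_fundamental_group loops_at_join loop_class_eq)
  qed
  show "\<one>\<^bsub>?G\<^esub> \<otimes>\<^bsub>?G\<^esub> x = x" if x: "x \<in> carrier ?G" for x
  proof -
    obtain p where *: "x = loop_class S p" "p \<in> loops_at S z"
      using x by auto
    have "homotopic_paths S ((\<lambda>_. pathstart p) +++ p) p"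
      by (rule homotopic_paths_const_join) (use * in \<open>auto simp: loops_at_def\<close>)
    then show ?thesis
      using * c(3) by (simp add: mult_fundamental_group one_fundamental_group)
        (auto simp: loops_at_def intro!: loop_class_eq)
  qed
  show "\<exists>y\<in>carrier ?G. y \<otimes>\<^bsub>?G\<^esub> x = \<one>\<^bsub>?G\<^esub>" if x: "x \<in> carrier ?G" for x
  proof -
    obtain p where *: "x = loop_class S p" "p \<in> loops_at S z"
      using x by auto
    have "homotopic_paths S (reversepath p +++ p) (\<lambda>_. pathfinish p)"
      by (rule homotopic_paths_reverse_join) (use * in \<open>auto simp: loops_at_def\<close>)
    then have "loop_class S (reversepath p +++ p) = \<one>\<^bsub>?G\<^esub>"
      using * by (auto simp: one_fundamental_group loops_at_def intro!: loop_class_eq)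
    then show ?thesis
      using * by (intro bexI[of _ "loop_class S (reversepath p)"])
        (simp_all add: mult_fundamental_group loops_at_reversepath)
  qed
qed

section \<open>Group-valued path functors\<close>

text \<open>In other words, a functor from the fundamental groupoid of \<open>S\<close> to a group
  regarded as a category with one object.\<close>

locale path_functor = group G for G (structure) +
  fixes S :: "'b::topological_space set" and F :: "(real \<Rightarrow> 'b) \<Rightarrow> 'g"
  assumes F_closed: "\<And>p. path p \<Longrightarrow> path_image p \<subseteq> S \<Longrightarrow> F p \<in> carrier G"
    and F_join: "\<And>p q. path p \<Longrightarrow> path_image p \<subseteq> S \<Longrightarrow> path q \<Longrightarrow> path_image q \<subseteq> S \<Longrightarrow>
        pathfinish p = pathstart q \<Longrightarrow> F (p +++ q) = F p \<otimes> F q"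
    and F_homotopic: "\<And>p q. homotopic_paths S p q \<Longrightarrow> F p = F q"
begin

text \<open>A constant path equals its own join with itself, so its value is an idempotent of a
  group.\<close>

lemma F_const: "x \<in> S \<Longrightarrow> F (\<lambda>_. x) = \<one>"
proof -
  assume x: "x \<in> S"
  then have "F ((\<lambda>_. x) +++ (\<lambda>_. x)) = F (\<lambda>_. x) \<otimes> F (\<lambda>_. x)"
    by (intro F_join) auto
  moreover have "(\<lambda>_. x) +++ (\<lambda>_. x) = (\<lambda>_. x)"
    by (auto simp: joinpaths_def)
  ultimately show ?thesis
    using F_closed[of "\<lambda>_. x"] x by (metis empty_subsetI insert_subset l_cancel_one' path_const path_image_const)
qed

lemma F_reverse:
  assumes "path p" "path_image p \<subseteq> S"
  shows "F (reversepath p) = inv (F p)"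
proof -
  have "F (reversepath p +++ p) = F (\<lambda>_. pathfinish p)"
    by (intro F_homotopic homotopic_paths_reverse_join assms)
  then have "F (reversepath p) \<otimes> F p = \<one>"
    using F_join[of "reversepath p" p] F_const[of "pathfinish p"] assms pathfinish_in_path_image by force
  then show ?thesis
    using F_closed[of p] F_closed[of "reversepath p"] assms inv_equality by auto
qed

end

text \<open>Base paths from \<open>z\<close> to every point turn the fundamental group into the target of a functor
  on all paths.\<close>

lemma path_functor_loop_class:
  fixes S :: "'b::topological_space set"
  assumes S: "path_connected S" "z \<in> S"
  obtains F where "path_functor (fundamental_group S z) S F"
    and "\<And>p. p \<in> loops_at S z \<Longrightarrow> F p = loop_class S p"
proof -
  let ?G = "fundamental_group S z"
  interpret group ?G by (rule group_fundamental_group[OF S(2)])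
  have "\<forall>x\<in>S. \<exists>g. path g \<and> path_image g \<subseteq> S \<and> pathstart g = z \<and> pathfinish g = x"
    using S unfolding path_connected_def by blast
  then obtain c0 where c0: "\<And>x. x \<in> S \<Longrightarrow> path (c0 x) \<and> path_image (c0 x) \<subseteq> S \<and> pathstart (c0 x) = z \<and> pathfinish (c0 x) = x"
    by metis
  \<comment> \<open>Making the base path at \<open>z\<close> itself constant is what lets
    \<open>F\<close> return \<open>loop_class S p\<close> on loops at \<open>z\<close>.\<close>
  define c where "c = c0(z := (\<lambda>_. z))"
  have c: "path (c x)" "path_image (c x) \<subseteq> S" "pathstart (c x) = z" "pathfinish (c x) = x" if "x \<in> S" for x
    using c0[OF that] S by (auto simp: c_def)
  define L where "L p = c (pathstart p) +++ (p +++ reversepath (c (pathfinish p)))" for p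
  define F where "F p = loop_class S (L p)" for p
  have L: "L p \<in> loops_at S z" if "path p" "path_image p \<subseteq> S" for p
  proof -
    have "pathstart p \<in> S" "pathfinish p \<in> S"
      using that by auto
    then show ?thesis
      using that c by (auto simp: L_def loops_at_def path_image_join)
  qed
  have "path_functor ?G S F"
  proof (unfold_locales)
    show "F p \<in> carrier ?G" if "path p" "path_image p \<subseteq> S" for p
      using L that by (auto simp: F_def)
    show "F p = F q" if "homotopic_paths S p q" for p q
    proof -
      note h = homotopic_paths_imp_path[OF that] homotopic_paths_imp_subset[OF that]
        homotopic_paths_imp_pathstart[OF that] homotopic_paths_imp_pathfinish[OF that]
      have "pathstart q \<in> S" "pathfinish q \<in> S" using h by auto
      then show ?thesis
        unfolding F_def L_def using h c that
        by (intro loop_class_eq) (auto intro!: homotopic_paths_join)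
    qed
    show "F (p +++ q) = F p \<otimes>\<^bsub>?G\<^esub> F q"
      if pq: "path p" "path_image p \<subseteq> S" "path q" "path_image q \<subseteq> S" "pathfinish p = pathstart q" for p q
    proof -
      let ?a = "c (pathstart p)" and ?b = "c (pathfinish p)" and ?d = "reversepath (c (pathfinish q))"
      have i: "pathstart p \<in> S" "pathfinish p \<in> S" "pathstart q \<in> S" "pathfinish q \<in> S"
        using pq by auto
      note simps = subset_path_image_join c i pq
      have "homotopic_paths S (L (p +++ q)) (?a +++ (p +++ q) +++ ?d)"
        unfolding L_def by (simp add: simps)
      also have "homotopic_paths S \<dots> (?a +++ p +++ q +++ ?d)"
        by (intro homotopic_paths_join[OF _ homotopic_paths_sym[OF homotopic_paths_assoc]]) (use simps in \<open>simp_all add: subset_path_image_join\<close>)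
      \<comment> \<open>A constant path is inserted at the junction and then expanded to
        \<open>reversepath ?b +++ ?b\<close>, which closes both factors up at
        \<open>z\<close>.\<close>
      also have "homotopic_paths S (?a +++ p +++ q +++ ?d) (?a +++ p +++ ((\<lambda>_. pathstart q) +++ q +++ ?d))"
      proof -
        have "homotopic_paths S (q +++ ?d) ((\<lambda>_. pathstart q) +++ q +++ ?d)"
          using homotopic_paths_sym[OF homotopic_paths_const_join[of "q +++ ?d" S]] simps
          by (simp add: subset_path_image_join)
        then show ?thesis
          by (intro homotopic_paths_join[OF _ homotopic_paths_join]) (use simps in auto)
      qed
      also have "homotopic_paths S \<dots> (?a +++ p +++ ((reversepath ?b +++ ?b) +++ q +++ ?d))"
      proof -
        have "homotopic_paths S (\<lambda>_. pathstart q) (reversepath ?b +++ ?b)"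
          using homotopic_paths_sym[OF homotopic_paths_reverse_join[of ?b S]] simps by simp
        then show ?thesis
          by (intro homotopic_paths_join[OF _ homotopic_paths_join[OF _ homotopic_paths_join]])
              (use simps in \<open>simp_all add: subset_path_image_join\<close>)
      qed
      also have "homotopic_paths S \<dots> (?a +++ p +++ reversepath ?b +++ ?b +++ q +++ ?d)"
        by (intro homotopic_paths_join[OF _ homotopic_paths_join[OF _
            homotopic_paths_sym[OF homotopic_paths_assoc]]])
            (use simps in \<open>simp_all add: subset_path_image_join\<close>)
      also have "homotopic_paths S \<dots> (?a +++ (p +++ reversepath ?b) +++ ?b +++ q +++ ?d)"
        by (intro homotopic_paths_join[OF _ homotopic_paths_assoc])
            (use simps in \<open>simp_all add: subset_path_image_join\<close>)
      also have "homotopic_paths S \<dots> (L p +++ L q)"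
        unfolding L_def pq(5)[symmetric] by (intro homotopic_paths_assoc)
            (use simps in \<open>simp_all add: subset_path_image_join\<close>)
      finally have "F (p +++ q) = loop_class S (L p +++ L q)"
        unfolding F_def by (rule loop_class_eq)
      then show ?thesis
        using L pq by (simp add: F_def mult_fundamental_group)
    qed
  qed
  moreover have "F p = loop_class S p" if "p \<in> loops_at S z" for p
  proof -
    have p: "path p" "path_image p \<subseteq> S" "pathstart p = z" "pathfinish p = z"
      using that by (auto simp: loops_at_def)
    have [simp]: "reversepath (\<lambda>_. z) = (\<lambda>_. z)" by (simp add: reversepath_def)
    have "homotopic_paths S (L p) (p +++ (\<lambda>_. z))"
      unfolding L_def using homotopic_paths_const_join[of "p +++ (\<lambda>_. z)" S] p S
      by (simp add: c_def path_image_join)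
    also have "homotopic_paths S \<dots> p"
      using homotopic_paths_join_const[of p S] p by simp
    finally show ?thesis
      unfolding F_def by (rule loop_class_eq)
  qed
  ultimately show ?thesis
    using that by blast
qed

section \<open>Homogeneous quasimorphisms\<close>

locale homogeneous_quasimorphism = group G for G (structure) +
  fixes \<phi> :: "'g \<Rightarrow> real" and D :: real
  assumes defect: "\<And>g h. g \<in> carrier G \<Longrightarrow> h \<in> carrier G \<Longrightarrow> \<bar>\<phi> (g \<otimes> h) - \<phi> g - \<phi> h\<bar> \<le> D"
    and nat_pow: "\<And>g k. g \<in> carrier G \<Longrightarrow> \<phi> (g [^] (k::nat)) = real k * \<phi> g"
begin

lemma defect_nonneg: "0 \<le> D"
  using defect[of \<one> \<one>] by (metis abs_ge_zero one_closed order_trans)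

lemma at_one [simp]: "\<phi> \<one> = 0"
  using nat_pow[of \<one> 0] by simp

lemma nat_pow_conj:
  assumes "g \<in> carrier G" "h \<in> carrier G"
  shows "(g \<otimes> h \<otimes> inv g) [^] (k::nat) = g \<otimes> h [^] k \<otimes> inv g"
proof (induction k)
  case (Suc k)
  then show ?case
    using assms by (simp add: m_assoc inv_solve_left)
      (metis inv_closed l_inv l_one m_assoc m_closed nat_pow_closed)
qed (use assms in simp)

text \<open>On powers of \<open>h\<close> the two sides differ by a bounded amount, so homogeneity makes them equal.\<close>

lemma conj_invariant:
  assumes g: "g \<in> carrier G" and h: "h \<in> carrier G"
  shows "\<phi> (g \<otimes> h \<otimes> inv g) = \<phi> h"
proof (rule ccontr)
  define e where "e = \<bar>\<phi> (g \<otimes> h \<otimes> inv g) - \<phi> h\<bar>"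
  define C where "C = 2 * D + \<bar>\<phi> g\<bar> + \<bar>\<phi> (inv g)\<bar>"
  assume "\<phi> (g \<otimes> h \<otimes> inv g) \<noteq> \<phi> h"
  then have "e > 0" by (simp add: e_def)
  have "real k * e \<le> C" for k :: nat
  proof -
    have "\<bar>\<phi> (g \<otimes> h [^] k \<otimes> inv g) - \<phi> (h [^] k)\<bar> \<le> C"
      using defect[of "g \<otimes> h [^] k" "inv g"] defect[of g "h [^] k"] g h unfolding C_def by simp
    then have "\<bar>real k * \<phi> (g \<otimes> h \<otimes> inv g) - real k * \<phi> h\<bar> \<le> C"
      using g h by (simp add: nat_pow flip: nat_pow_conj)
    then show ?thesis
      by (simp add: e_def abs_mult flip: right_diff_distrib)
  qed
  moreover obtain k :: nat where "C < real k * e"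
    using \<open>e > 0\<close> reals_Archimedean3 by blast
  ultimately show False by (meson not_le)
qed

end

section \<open>Undistorted elements\<close>

text \<open>Fekete's argument: the limit is the infimum of the quotients. For \<open>m\<close>
  nearly attaining it, division of \<open>n\<close> by \<open>m\<close> with remainder bounds
  \<open>u n / real n\<close> from above.\<close>

lemma fekete_subadditive_convergent:
  fixes u :: "nat \<Rightarrow> real"
  assumes sub: "\<And>m n. u (m + n) \<le> u m + u n" and nonneg: "\<And>n. 0 \<le> u n"
  obtains L where "(\<lambda>n. u n / real n) \<longlonglongrightarrow> L"
proof -
  define L where "L = (INF n\<in>{1..}. u n / real n)"
  have bdd: "bdd_below ((\<lambda>n. u n / real n) ` {1..})"
    by (rule bdd_belowI2[of _ 0]) (simp add: nonneg)
  \<comment> \<open>The case \<open>k = 0\<close> must be left out because \<open>u 0\<close> may be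
    positive; hence the case distinction on \<open>n div m\<close> below.\<close>
  have mult: "u (k * n) \<le> real k * u n" if "k > 0" for k n
    using that
  proof (induction k)
    case (Suc k)
    show ?case
    proof (cases "k = 0")
      case False
      then show ?thesis
        using Suc sub[of n "k * n"] by (simp add: algebra_simps)
    qed simp
  qed simp
  have "(\<lambda>n. u n / real n) \<longlonglongrightarrow> L"
  proof (rule LIMSEQ_I)
    fix e :: real assume "e > 0"
    then obtain m where m: "m \<ge> 1" "u m / real m < L + e / 2"
      using cINF_less_iff[OF _ bdd, of "L + e / 2"] unfolding L_def by auto
    \<comment> \<open>\<open>B\<close> bounds the contribution of the remainder independently of
      \<open>n\<close>; the choice of \<open>N\<close> makes it smaller than half of
      \<open>e\<close> after division by \<open>n\<close>.\<close>
    define B where "B = Max (u ` {..m}) + u m"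
    have B: "u r + u m \<le> B" if "r \<le> m" for r
      unfolding B_def using that by simp
    obtain N :: nat where N: "B < real N * (e / 2)"
      using reals_Archimedean3[of "e / 2"] \<open>e > 0\<close> by auto
    have "\<bar>u n / real n - L\<bar> < e" if n: "n \<ge> max 1 N" for n
    proof -
      have "L \<le> u n / real n"
        unfolding L_def using n bdd by (intro cINF_lower) auto
      moreover have "u n / real n < L + e"
      proof -
        have "u n \<le> real (n div m) * u m + B"
        proof (cases "n div m = 0")
          case True
          then have "n \<le> m" using m by (simp add: div_eq_0_iff)
          then show ?thesis using B[of n] nonneg[of m] True by simp
        next
          case False
          have "n = n div m * m + n mod m" by simp
          then have "u n \<le> u (n div m * m) + u (n mod m)"
            using sub by metis
          also have "\<dots> \<le> real (n div m) * u m + u (n mod m)"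
            using mult[of "n div m" m] False by simp
          also have "\<dots> \<le> real (n div m) * u m + B"
            using B[of "n mod m"] nonneg[of m] m by (simp add: less_imp_le)
          finally show ?thesis .
        qed
        also have "real (n div m) * u m \<le> real n / real m * u m"
          using nonneg[of m] by (intro mult_right_mono of_nat_div_le_of_nat)
        also have "\<dots> \<le> real n * (L + e / 2)"
          using m(2) n mult_left_mono[of "u m / real m" "L + e / 2" "real n"] by simp
        also have "B < real n * (e / 2)"
          using N n \<open>e > 0\<close> by (smt (verit, best) max.bounded_iff mult_right_mono of_nat_le_iff half_gt_zero)
        finally have "u n < real n * (L + e)"
          by (simp add: algebra_simps)
        then show ?thesis
          using n by (simp add: divide_less_eq mult.commute)
      qed
      ultimately show ?thesis by simp
    qed
    then show "\<exists>N. \<forall>n\<ge>N. norm (u n / real n - L) < e"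
      by (metis real_norm_def)
  qed
  then show ?thesis using that by blast
qed

context group
begin

lemma inv_mult_cancel: "x \<in> carrier G \<Longrightarrow> y \<in> carrier G \<Longrightarrow> inv x \<otimes> (x \<otimes> y) = y"
  by (simp flip: m_assoc)

lemma mult_inv_cancel: "x \<in> carrier G \<Longrightarrow> y \<in> carrier G \<Longrightarrow> x \<otimes> (inv x \<otimes> y) = y"
  by (simp flip: m_assoc)

lemma foldr_mult_closed: "set ws \<subseteq> carrier G \<Longrightarrow> foldr (\<otimes>) ws \<one> \<in> carrier G"
  by (induction ws) auto

lemma foldr_mult_append:
  "set us \<subseteq> carrier G \<Longrightarrow> set vs \<subseteq> carrier G \<Longrightarrow>
    foldr (\<otimes>) (us @ vs) \<one> = foldr (\<otimes>) us \<one> \<otimes> foldr (\<otimes>) vs \<one>"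
  by (induction us) (auto simp: foldr_mult_closed m_assoc)

lemma generate_imp_word:
  assumes "S \<subseteq> carrier G" "g \<in> generate G S"
  shows "\<exists>ws. set ws \<subseteq> S \<union> m_inv G ` S \<and> foldr (\<otimes>) ws \<one> = g"
  using assms(2)
proof induction
  case one
  show ?case by (intro exI[of _ "[]"]) simp
next
  case (incl h)
  then show ?case using assms(1) by (intro exI[of _ "[h]"]) auto
next
  case (inv h)
  then show ?case using assms(1) by (intro exI[of _ "[inv h]"]) auto
next
  case (eng h1 h2)
  then obtain us vs where "set us \<subseteq> S \<union> m_inv G ` S" "foldr (\<otimes>) us \<one> = h1"
    "set vs \<subseteq> S \<union> m_inv G ` S" "foldr (\<otimes>) vs \<one> = h2"
    by blast
  moreover have "S \<union> m_inv G ` S \<subseteq> carrier G"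
    using assms(1) by auto
  ultimately show ?case
    by (intro exI[of _ "us @ vs"]) (use foldr_mult_append[of us vs] in auto)
qed

text \<open>Shortest words can be concatenated, so the word norm along powers is subadditive and
  Fekete's lemma gives a limit. The hypothesis, applied to a shortest word for each power, bounds
  this limit below by \<open>a / c\<close>.\<close>

lemma undistorted_fgI:
  assumes g: "g \<in> carrier G" and a: "0 < (a::real)"
    and bound: "\<And>S. finite_generating_set G S \<Longrightarrow> \<exists>b c. 0 < c \<and> (\<forall>k ws. set ws \<subseteq> S \<union> m_inv G ` S \<longrightarrow>
      foldr (\<otimes>) ws \<one> = g [^] (k::nat) \<longrightarrow> real k * a - b \<le> c * real (length ws))"
  shows "undistorted_fg G g"
  unfolding undistorted_fg_def
proof (intro allI impI)
  fix S assume S: "finite_generating_set G S"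
  then have S': "S \<subseteq> carrier G" "generate G S = carrier G"
    by (auto simp: finite_generating_set_def)
  let ?T = "S \<union> m_inv G ` S"
  have T: "?T \<subseteq> carrier G" using S' by auto
  \<comment> \<open>Generation ensures that the \<open>LEAST\<close> in \<open>word_norm\<close> is
    attained.\<close>
  have ex: "\<exists>ws. length ws = word_norm G S h \<and> set ws \<subseteq> ?T \<and> foldr (\<otimes>) ws \<one> = h"
    if h: "h \<in> carrier G" for h
  proof -
    obtain ws where "set ws \<subseteq> ?T" "foldr (\<otimes>) ws \<one> = h"
      using generate_imp_word[of S h] S' h by auto
    then show ?thesis
      unfolding word_norm_def
      by (intro LeastI[where P = "\<lambda>l. \<exists>ws. length ws = l \<and> set ws \<subseteq> ?T \<and> foldr (\<otimes>) ws \<one> = h"]) blast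
  qed
  have le: "word_norm G S h \<le> length ws" if "set ws \<subseteq> ?T" "foldr (\<otimes>) ws \<one> = h" for h ws
    unfolding word_norm_def using that by (intro Least_le) blast
  define u where "u k = real (word_norm G S (g [^] k))" for k :: nat
  have "u (m + n) \<le> u m + u n" for m n
  proof -
    obtain us where us: "length us = word_norm G S (g [^] m)" "set us \<subseteq> ?T" "foldr (\<otimes>) us \<one> = g [^] m"
      using ex[of "g [^] m"] g by auto
    obtain vs where vs: "length vs = word_norm G S (g [^] n)" "set vs \<subseteq> ?T" "foldr (\<otimes>) vs \<one> = g [^] n"
      using ex[of "g [^] n"] g by auto
    have "foldr (\<otimes>) (us @ vs) \<one> = g [^] (m + n)"
      using us vs T g by (subst foldr_mult_append) (auto simp: nat_pow_mult)
    then have "word_norm G S (g [^] (m + n)) \<le> length (us @ vs)"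
      using us vs by (intro le) auto
    then show ?thesis using us(1) vs(1) by (simp add: u_def)
  qed
  then obtain L where L: "(\<lambda>n. u n / real n) \<longlonglongrightarrow> L"
    by (rule fekete_subadditive_convergent) (auto simp: u_def)
  obtain b c where c: "0 < c" and bc: "\<And>k ws. set ws \<subseteq> ?T \<Longrightarrow> foldr (\<otimes>) ws \<one> = g [^] (k::nat) \<Longrightarrow>
      real k * a - b \<le> c * real (length ws)"
    using bound[OF S] by blast
  have "(a - b / real k) / c \<le> u k / real k" if "k \<ge> 1" for k
  proof -
    obtain us where us: "length us = word_norm G S (g [^] k)" "set us \<subseteq> ?T" "foldr (\<otimes>) us \<one> = g [^] k"
      using ex[of "g [^] k"] g by auto
    have "real k * a - b \<le> c * u k"
      using bc[OF us(2,3)] us(1) by (simp add: u_def)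
    then have "(real k * a - b) / real k / c \<le> c * u k / real k / c"
      using c by (intro divide_right_mono) auto
    then show ?thesis
      using c that by (simp add: diff_divide_distrib)
  qed
  moreover have "(\<lambda>k. (a - b / real k) / c) \<longlonglongrightarrow> (a - 0) / c"
    by (intro tendsto_intros tendsto_divide_0[OF tendsto_const] filterlim_real_sequentially) (use c in auto)
  ultimately have "(a - 0) / c \<le> L"
    using L by (intro tendsto_le[OF _ L]) (auto simp: eventually_at_top_linorder)
  then have "L > 0"
    using a c by (smt (verit) divide_pos_pos)
  then show "\<exists>L>0. (\<lambda>k::nat. real (word_norm G S (g [^] k)) / real k) \<longlonglongrightarrow> L"
    using L unfolding u_def by blast
qed

end

section \<open>Quasimorphisms evaluated on twisted traces of paths\<close>

locale quasimorphism_functor = homogeneous_quasimorphism G \<phi> D + path_functor G S F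
  for G (structure) and \<phi> :: "'g \<Rightarrow> real" and D and S :: "'b::topological_space set" and F
begin

text \<open>A change of gauge: \<open>g\<close> replaces the base paths that are built into
  \<open>F\<close> by others. On closed paths it has no effect, since \<open>\<phi>\<close> is
  conjugation invariant; the freedom concerns open paths, where it is used to achieve
  boundedness.\<close>

definition twisted :: "('b \<Rightarrow> 'g) \<Rightarrow> (real \<Rightarrow> 'b) \<Rightarrow> real" where
  "twisted g p = \<phi> (g (pathstart p) \<otimes> F p \<otimes> inv (g (pathfinish p)))"

text \<open>The twists at the common end point cancel, so the defect stays the one of
  \<open>\<phi>\<close>.\<close>

lemma twisted_join:
  assumes g: "g \<in> S \<rightarrow> carrier G"
    and p: "path p" "path_image p \<subseteq> S" and q: "path q" "path_image q \<subseteq> S"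
    and pq: "pathfinish p = pathstart q"
  shows "\<bar>twisted g (p +++ q) - twisted g p - twisted g q\<bar> \<le> D"
proof -
  let ?a = "g (pathstart p)" and ?b = "g (pathstart q)" and ?c = "g (pathfinish q)"
  have "pathstart p \<in> S" "pathstart q \<in> S" "pathfinish q \<in> S"
    using p q by auto
  then have c: "?a \<in> carrier G" "?b \<in> carrier G" "?c \<in> carrier G" "F p \<in> carrier G" "F q \<in> carrier G"
    using g F_closed p q by auto
  then have "?a \<otimes> (F p \<otimes> F q) \<otimes> inv ?c = (?a \<otimes> F p \<otimes> inv ?b) \<otimes> (?b \<otimes> F q \<otimes> inv ?c)"
    by (simp add: m_assoc inv_mult_cancel)
  then show ?thesis
    unfolding twisted_def using F_join[OF p q pq] defect[of "?a \<otimes> F p \<otimes> inv ?b" "?b \<otimes> F q \<otimes> inv ?c"] c pq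
    by simp
qed

lemma twisted_homotopic:
  assumes "homotopic_paths S p q"
  shows "twisted g p = twisted g q"
  unfolding twisted_def
  using F_homotopic[OF assms] homotopic_paths_imp_pathstart[OF assms] homotopic_paths_imp_pathfinish[OF assms]
  by simp

text \<open>The twist at \<open>x\<close> is the value of \<open>F\<close> on a path to \<open>x\<close> from the reference point of a member of a
  finite cover by good sets. A path inside a small neighbourhood of \<open>X\<close> then closes up, modulo two
  loops in good sets, to a path depending only on the two members of the cover involved.\<close>

lemma locally_bounded_twist:
  fixes good :: "'b set \<Rightarrow> bool"
  assumes compact: "compact (UNIV :: 'b set)"
    and good: "\<And>W. good W \<Longrightarrow> open W" "\<And>W. good W \<Longrightarrow> path_connected (W \<inter> S)" "\<And>W. good W \<Longrightarrow> W \<inter> S \<noteq> {}"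
    and loops: "\<And>W p. good W \<Longrightarrow> path p \<Longrightarrow> path_image p \<subseteq> W \<inter> S \<Longrightarrow> pathfinish p = pathstart p \<Longrightarrow> \<phi> (F p) = 0"
    and basis: "\<And>U X. open U \<Longrightarrow> X \<in> U \<Longrightarrow> \<exists>W. good W \<and> X \<in> W \<and> W \<subseteq> U"
    and regular: "\<And>U X. open U \<Longrightarrow> X \<in> U \<Longrightarrow> \<exists>V C. open V \<and> closed C \<and> (X::'b) \<in> V \<and> V \<subseteq> C \<and> C \<subseteq> U"
  obtains g where "g \<in> S \<rightarrow> carrier G"
    and "\<And>X. \<exists>W C. open W \<and> X \<in> W \<and> (\<forall>e. path e \<longrightarrow> path_image e \<subseteq> W \<inter> S \<longrightarrow> \<bar>twisted g e\<bar> \<le> C)"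
proof -
  \<comment> \<open>Three nested sets are kept for each member of the cover: the open
    \<open>V\<close> covers, the good \<open>W\<close> carries the paths, and the closed
    \<open>C\<close> in between controls which members can matter near a given point.\<close>
  have "\<exists>W V C. good W \<and> open V \<and> closed C \<and> X \<in> V \<and> V \<subseteq> C \<and> C \<subseteq> W" for X
    using basis[of UNIV X] regular good(1) by (metis UNIV_I open_UNIV)
  then obtain W V C where WVC: "\<And>X. good (W X)" "\<And>X. open (V X)" "\<And>X. closed (C X)" "\<And>X. X \<in> V X"
    "\<And>X. V X \<subseteq> C X" "\<And>X. C X \<subseteq> W X"
    by metis
  obtain I where I: "finite I" "UNIV \<subseteq> (\<Union>k\<in>I. V k)"
    by (rule compactE_image[OF compact, of UNIV V]) (use WVC in auto)
  then have "\<forall>x. \<exists>k\<in>I. x \<in> V k" by auto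
  then obtain \<kappa> where \<kappa>: "\<And>x. \<kappa> x \<in> I" "\<And>x. x \<in> V (\<kappa> x)" by metis
  have "\<forall>k. \<exists>x. x \<in> W k \<inter> S" using good(3) WVC(1) by blast
  then obtain r where r: "\<And>k. r k \<in> W k \<inter> S" by metis
  define e where
    "e k x = (SOME e. path e \<and> path_image e \<subseteq> W k \<inter> S \<and> pathstart e = r k \<and> pathfinish e = x)" for k x
  have e: "path (e k x) \<and> path_image (e k x) \<subseteq> W k \<inter> S \<and> pathstart (e k x) = r k \<and> pathfinish (e k x) = x"
    if "x \<in> W k \<inter> S" for k x
  proof -
    have "\<exists>e. path e \<and> path_image e \<subseteq> W k \<inter> S \<and> pathstart e = r k \<and> pathfinish e = x"
      using good(2)[OF WVC(1), of k] r[of k] that unfolding path_connected_def by blast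
    then show ?thesis
      unfolding e_def by (rule someI_ex)
  qed
  define g where "g x = F (e (\<kappa> x) x)" for x
  have inW: "x \<in> W (\<kappa> x)" for x
    using \<kappa> WVC by blast
  have g: "g \<in> S \<rightarrow> carrier G"
    using e inW F_closed by (auto simp: g_def)
  moreover have "\<exists>N c. open N \<and> X \<in> N \<and> (\<forall>p. path p \<longrightarrow> path_image p \<subseteq> N \<inter> S \<longrightarrow> \<bar>twisted g p\<bar> \<le> c)" for X
  proof -
    \<comment> \<open>A point of \<open>V k\<close> lies in \<open>C k\<close>, so removing every
      \<open>C k\<close> that misses \<open>X\<close> leaves only members with \<open>X\<close> in
      \<open>C k\<close> as values of \<open>\<kappa>\<close>. Hence \<open>N\<close> lies in
      \<open>W (\<kappa> x)\<close> for each of its points \<open>x\<close>.\<close>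
    let ?N = "(\<Inter>k\<in>{k\<in>I. X \<in> C k}. W k) \<inter> (\<Inter>k\<in>{k\<in>I. X \<notin> C k}. - C k)"
    have oN: "open ?N"
      using I WVC good(1) by (intro open_Int open_INT) auto
    have XN: "X \<in> ?N" using WVC(6) by blast
    obtain N where N: "good N" "X \<in> N" "N \<subseteq> ?N"
      using basis[OF oN XN] by blast
    have NW: "N \<subseteq> W (\<kappa> x)" if "x \<in> N" for x
    proof -
      have "x \<in> C (\<kappa> x)" using \<kappa>(2) WVC(5) by blast
      then have "X \<in> C (\<kappa> x)"
        using subsetD[OF N(3) that] \<kappa>(1)[of x] by blast
      then show ?thesis
        using N(3) \<kappa>(1)[of x] by blast
    qed
    obtain w where w: "w \<in> N \<inter> S" using good(3) N(1) by blast
    \<comment> \<open>If \<open>w\<close> lies outside \<open>W k\<close>, then \<open>e k w\<close>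
      is an arbitrary choice; this does no harm, as the maximum is over finitely many pairs anyway.
      The summand \<open>2 * D\<close> pays for splitting off two loops.\<close>
    define c where "c = Max ((\<lambda>(k, l). \<bar>\<phi> (F (e k w) \<otimes> inv (F (e l w)))\<bar>) ` (I \<times> I)) + 2 * D"
    have c: "\<bar>\<phi> (F (e k w) \<otimes> inv (F (e l w)))\<bar> + 2 * D \<le> c" if "k \<in> I" "l \<in> I" for k l
      unfolding c_def using that I(1)
      by (intro add_right_mono Max_ge) (auto intro!: image_eqI[where x = "(k, l)"])
    have "\<bar>twisted g p\<bar> \<le> c" if p: "path p" "path_image p \<subseteq> N \<inter> S" for p
    proof -
      define x y where "x = pathstart p" and "y = pathfinish p"
      define k l where "k = \<kappa> x" and "l = \<kappa> y"
      have xy: "x \<in> N \<inter> S" "y \<in> N \<inter> S" using p by (auto simp: x_def y_def)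
      then have NWk: "N \<subseteq> W k" "N \<subseteq> W l" using NW by (auto simp: k_def l_def)
      obtain h where h: "path h" "path_image h \<subseteq> N \<inter> S" "pathstart h = x" "pathfinish h = w"
        using good(2)[OF N(1)] xy(1) w unfolding path_connected_def by blast
      have ek: "path (e k x)" "path_image (e k x) \<subseteq> W k \<inter> S" "pathstart (e k x) = r k" "pathfinish (e k x) = x"
        "path (e k w)" "path_image (e k w) \<subseteq> W k \<inter> S" "pathstart (e k w) = r k" "pathfinish (e k w) = w"
        using e[of x k] e[of w k] xy w NWk by auto
      have el: "path (e l y)" "path_image (e l y) \<subseteq> W l \<inter> S" "pathstart (e l y) = r l" "pathfinish (e l y) = y"
        "path (e l w)" "path_image (e l w) \<subseteq> W l \<inter> S" "pathstart (e l w) = r l" "pathfinish (e l w) = w"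
        using e[of y l] e[of w l] xy w NWk by auto
      \<comment> \<open>\<open>?a\<close> is a loop at \<open>r k\<close> inside \<open>W k\<close>
        and \<open>?b\<close> a loop at \<open>r l\<close> inside \<open>W l\<close>. Both pass
        through the reference point \<open>w\<close> of \<open>N\<close> along \<open>h\<close>, so
        the two contributions of \<open>h\<close> cancel in the product.\<close>
      let ?a = "e k x +++ h +++ reversepath (e k w)"
      let ?b = "e l w +++ (reversepath h +++ p +++ reversepath (e l y))"
      note simps = h x_def[symmetric] y_def[symmetric] p
      have hW: "path_image h \<subseteq> W k \<inter> S" "path_image h \<subseteq> W l \<inter> S" "path_image p \<subseteq> W l \<inter> S"
        using h p NWk by auto
      have subS: "path_image h \<subseteq> S" "path_image p \<subseteq> S" "path_image (e k x) \<subseteq> S" "path_image (e k w) \<subseteq> S"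
         "path_image (e l y) \<subseteq> S" "path_image (e l w) \<subseteq> S"
        using h p ek el by auto
      have "\<phi> (F ?a) = 0"
        by (rule loops[OF WVC(1)[of k]])
          (use simps ek hW in \<open>simp_all add: subset_path_image_join\<close>)
      moreover have "F ?a = F (e k x) \<otimes> (F h \<otimes> inv (F (e k w)))"
        using simps ek subS by (simp add: F_join F_reverse subset_path_image_join)
      moreover have "\<phi> (F ?b) = 0"
        by (rule loops[OF WVC(1)[of l]])
          (use simps el hW in \<open>simp_all add: subset_path_image_join\<close>)
      moreover have "F ?b = F (e l w) \<otimes> (inv (F h) \<otimes> (F p \<otimes> inv (F (e l y))))"
        using simps el subS by (simp add: F_join F_reverse subset_path_image_join)
      moreover have cl: "F (e k x) \<in> carrier G" "F h \<in> carrier G" "F (e k w) \<in> carrier G" "F (e l w) \<in> carrier G"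
        "F (e l y) \<in> carrier G" "F p \<in> carrier G"
        using F_closed simps ek el subS by auto
      then have "F (e k x) \<otimes> F p \<otimes> inv (F (e l y)) =
        (F (e k x) \<otimes> (F h \<otimes> inv (F (e k w)))) \<otimes> (F (e k w) \<otimes> inv (F (e l w))) \<otimes>
        (F (e l w) \<otimes> (inv (F h) \<otimes> (F p \<otimes> inv (F (e l y)))))"
        by (simp add: m_assoc inv_mult_cancel mult_inv_cancel)
      then have "twisted g p = \<phi> (F ?a \<otimes> (F (e k w) \<otimes> inv (F (e l w))) \<otimes> F ?b)"
        unfolding twisted_def g_def x_def[symmetric] y_def[symmetric] k_def[symmetric] l_def[symmetric]
        using calculation by simp
      moreover have "F ?a \<in> carrier G" "F ?b \<in> carrier G"
        using calculation cl by simp_all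
      ultimately have "\<bar>twisted g p\<bar> \<le> \<bar>\<phi> (F (e k w) \<otimes> inv (F (e l w)))\<bar> + 2 * D"
        using defect[of "F ?a" "F (e k w) \<otimes> inv (F (e l w))"]
          defect[of "F ?a \<otimes> (F (e k w) \<otimes> inv (F (e l w)))" "F ?b"] cl by simp
      then show ?thesis
        using c[of k l] \<kappa> by (auto simp: k_def l_def)
    qed
    then show ?thesis
      using N(2) good(1)[OF N(1)] by (intro exI[of _ N] exI[of _ c]) simp
  qed
  ultimately show ?thesis by (rule that)
qed

text \<open>By compactness of the ambient space, around each time there is an interval length that
  works for all \<open>x\<close> simultaneously: traces over shorter intervals stay in one of
  finitely many sets on which \<open>twisted g\<close> is bounded. Joining intervals costs one
  defect each, and a bisection argument in time finishes.\<close>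

lemma twisted_flow_bounded:
  fixes E :: "real \<times> 'b \<Rightarrow> 'b"
  assumes compact: "compact (UNIV :: 'b set)"
    and g: "g \<in> S \<rightarrow> carrier G"
    and bdd: "\<And>X. \<exists>W C. open W \<and> X \<in> W \<and> (\<forall>e. path e \<longrightarrow> path_image e \<subseteq> W \<inter> S \<longrightarrow> \<bar>twisted g e\<bar> \<le> C)"
    and E: "continuous_on ({0..1} \<times> UNIV) E" "E ` ({0..1} \<times> S) \<subseteq> S"
  obtains C where "\<And>x. x \<in> S \<Longrightarrow> \<bar>twisted g (\<lambda>t. E (t, x))\<bar> \<le> C"
proof -
  have E': "continuous_on {0..1} (\<lambda>t. E (t, x))" for x
    by (rule continuous_on_compose2[OF E(1)]) (auto intro!: continuous_intros)
  have sub: "path ((\<lambda>t. E (t, x)) \<circ> linepath a b)" "path_image ((\<lambda>t. E (t, x)) \<circ> linepath a b) = (\<lambda>t. E (t, x)) ` {a..b}"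
    if "0 \<le> a" "a \<le> b" "b \<le> 1" for x a b
  proof -
    have ab: "linepath a b ` {0..1} = {a..b}"
      using that by (metis closed_segment_eq_real_ivl linepath_image_01)
    then show "path_image ((\<lambda>t. E (t, x)) \<circ> linepath a b) = (\<lambda>t. E (t, x)) ` {a..b}"
      unfolding path_image_def image_comp[symmetric] by (rule arg_cong)
    show "path ((\<lambda>t. E (t, x)) \<circ> linepath a b)"
      unfolding path_def using that ab
      by (intro continuous_on_compose continuous_on_linepath continuous_on_subset[OF E']) auto
  qed
  \<comment> \<open>The premises make \<open>P\<close> vacuous for intervals that leave the unit
    interval, since the local condition in \<open>Bolzano\<close> ranges over all real
    \<open>a\<close> and \<open>b\<close> around \<open>t\<close>.\<close>
  define P where "P a b \<longleftrightarrow> (0 \<le> a \<longrightarrow> b \<le> 1 \<longrightarrow>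
    (\<exists>C. \<forall>x\<in>S. \<bar>twisted g ((\<lambda>t. E (t, x)) \<circ> linepath a b)\<bar> \<le> C))" for a b
  have "P 0 1"
  proof (rule Bolzano)
    show "(0::real) \<le> 1" by simp
  next
    fix a b c :: real
    assume P: "P a b" "P b c" and ab: "a \<le> b" "b \<le> c"
    show "P a c"
      unfolding P_def
    proof (intro impI)
      assume ac: "0 \<le> a" "c \<le> 1"
      then obtain C C' where C: "\<And>x. x \<in> S \<Longrightarrow> \<bar>twisted g ((\<lambda>t. E (t, x)) \<circ> linepath a b)\<bar> \<le> C"
        and C': "\<And>x. x \<in> S \<Longrightarrow> \<bar>twisted g ((\<lambda>t. E (t, x)) \<circ> linepath b c)\<bar> \<le> C'"
        using P ab unfolding P_def by (meson order_trans)
      have "\<bar>twisted g ((\<lambda>t. E (t, x)) \<circ> linepath a c)\<bar> \<le> C + C' + D" if x: "x \<in> S" for x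
      proof -
        let ?f = "\<lambda>t. E (t, x)"
        have f: "?f ` {0..1} \<subseteq> S" using E(2) x by auto
        have "homotopic_paths S (?f \<circ> (linepath a b +++ linepath b c)) (?f \<circ> linepath a c)"
          by (rule homotopic_paths_compose_convex[where T = "{0..1}"])
            (use E' f ab ac in \<open>auto simp: path_image_join closed_segment_eq_real_ivl\<close>)
        then have "twisted g (?f \<circ> linepath a c) = twisted g ((?f \<circ> linepath a b) +++ (?f \<circ> linepath b c))"
          using twisted_homotopic by (metis path_compose_join)
        moreover have "path_image (?f \<circ> linepath a b) \<subseteq> S" "path_image (?f \<circ> linepath b c) \<subseteq> S"
          using f sub(2)[of a b x] sub(2)[of b c x] ab ac by (auto simp: image_subset_iff)
        ultimately show ?thesis
          using twisted_join[OF g, of "?f \<circ> linepath a b" "?f \<circ> linepath b c"] C[OF x] C'[OF x]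
            sub(1)[of a b x] sub(1)[of b c x] ab ac
          by (simp add: pathfinish_compose pathstart_compose)
      qed
      then show "\<exists>C. \<forall>x\<in>S. \<bar>twisted g ((\<lambda>t. E (t, x)) \<circ> linepath a c)\<bar> \<le> C" by blast
    qed
  next
    fix t :: real assume t: "0 \<le> t" "t \<le> 1"
    have "\<exists>B d C. open B \<and> X \<in> B \<and> d > 0 \<and> (\<forall>a b. \<forall>x\<in>B \<inter> S. 0 \<le> a \<and> b \<le> 1 \<and> a \<le> t \<and> t \<le> b \<and> b - a < d \<longrightarrow>
      \<bar>twisted g ((\<lambda>t. E (t, x)) \<circ> linepath a b)\<bar> \<le> C)" for X
    proof -
      obtain W C where W: "open W" "E (t, X) \<in> W"
        "\<And>e. path e \<Longrightarrow> path_image e \<subseteq> W \<inter> S \<Longrightarrow> \<bar>twisted g e\<bar> \<le> C"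
        using bdd[of "E (t, X)"] by blast
      obtain O' where O': "open O'" "E -` W \<inter> ({0..1} \<times> UNIV) = O' \<inter> ({0..1} \<times> UNIV)"
        using E(1) W(1) unfolding continuous_on_open_invariant by metis
      have "(t, X) \<in> O'" using W(2) O'(2) t by auto
      then obtain A B where AB: "open A" "open B" "t \<in> A" "X \<in> B" "A \<times> B \<subseteq> O'"
        using O'(1) by (metis mem_Sigma_iff open_prod_elim)
      obtain d where d: "d > 0" "ball t d \<subseteq> A"
        using AB openE by blast
      have "\<bar>twisted g ((\<lambda>t. E (t, x)) \<circ> linepath a b)\<bar> \<le> C"
        if "x \<in> B \<inter> S" "0 \<le> a" "b \<le> 1" "a \<le> t" "t \<le> b" "b - a < d" for a b x
      proof (rule W(3))
        show "path ((\<lambda>t. E (t, x)) \<circ> linepath a b)" by (rule sub) (use that in auto)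
        have "E (s, x) \<in> W \<inter> S" if s: "s \<in> {a..b}" for s
        proof -
          have "s \<in> ball t d" using s \<open>a \<le> t\<close> \<open>t \<le> b\<close> \<open>b - a < d\<close> by (auto simp: dist_real_def)
          then have "(s, x) \<in> O'" using d AB \<open>x \<in> B \<inter> S\<close> by auto
          moreover have "s \<in> {0..1}" using s \<open>0 \<le> a\<close> \<open>b \<le> 1\<close> by auto
          ultimately show ?thesis using O'(2) E(2) \<open>x \<in> B \<inter> S\<close> by auto
        qed
        then show "path_image ((\<lambda>t. E (t, x)) \<circ> linepath a b) \<subseteq> W \<inter> S"
          using sub(2)[of a b x] that by auto
      qed
      then show ?thesis using AB d by blast
    qed
    then obtain B d C where B: "\<And>X. open (B X)" "\<And>X. X \<in> B X" "\<And>X. d X > 0"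
      and C: "\<And>X a b x. x \<in> B X \<inter> S \<Longrightarrow> 0 \<le> a \<Longrightarrow> b \<le> 1 \<Longrightarrow> a \<le> t \<Longrightarrow> t \<le> b \<Longrightarrow> b - a < d X \<Longrightarrow>
        \<bar>twisted g ((\<lambda>t. E (t, x)) \<circ> linepath a b)\<bar> \<le> C X"
      by metis
    obtain I where I: "finite I" "UNIV \<subseteq> (\<Union>k\<in>I. B k)"
      by (rule compactE_image[OF compact, of UNIV B]) (use B in auto)
    then have "I \<noteq> {}" by auto
    define \<delta> where "\<delta> = Min (d ` I)"
    have "\<delta> > 0" using B I \<open>I \<noteq> {}\<close> by (simp add: \<delta>_def)
    moreover have "P a b" if ab: "a \<le> t \<and> t \<le> b \<and> b - a < \<delta>" for a b
      unfolding P_def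
    proof (intro impI exI ballI)
      fix x assume *: "0 \<le> a" "b \<le> 1" "x \<in> S"
      obtain X where X: "X \<in> I" "x \<in> B X" using I by auto
      then have "b - a < d X" using ab I(1) unfolding \<delta>_def by (smt (verit) Min_le finite_imageI imageI)
      then have "\<bar>twisted g ((\<lambda>t. E (t, x)) \<circ> linepath a b)\<bar> \<le> C X"
        using * ab X by (intro C) auto
      also have "C X \<le> Max (C ` I)" using X I by simp
      finally show "\<bar>twisted g ((\<lambda>t. E (t, x)) \<circ> linepath a b)\<bar> \<le> Max (C ` I)" .
    qed
    ultimately show "\<exists>d>0. \<forall>a b. a \<le> t \<and> t \<le> b \<and> b - a < d \<longrightarrow> P a b" by blast
  qed
  then show ?thesis
    using that unfolding P_def path_comp_id_linepath by auto
qed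

end

section \<open>Configuration spaces\<close>

lemma regular_compact_t2:
  assumes "compact (UNIV :: 'a::t2_space set)" "open U" "(x::'a) \<in> U"
  obtains V C where "open V" "closed C" "x \<in> V" "V \<subseteq> C" "C \<subseteq> U"
proof -
  have "Hausdorff_space (euclidean :: 'a topology)"
    unfolding Hausdorff_space_def by (simp add: disjnt_def) (metis hausdorff)
  then have "regular_space (euclidean :: 'a topology)"
    using assms(1) by (intro compact_Hausdorff_imp_regular_space) (simp_all add: compact_space_def)
  moreover have "closed (- U)" "x \<notin> - U"
    using assms by auto
  ultimately obtain V W where "open V" "open W" "x \<in> V" "- U \<subseteq> W" "disjnt V W"
    unfolding regular_space_def
    by (metis Compl_eq_Diff_UNIV DiffI UNIV_I closed_closedin open_openin topspace_euclidean)
  then show ?thesis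
    by (intro that[of V "- W"]) (auto simp: disjnt_def)
qed

text \<open>Tychonoff applies to functions; \<open>vec\<close> is a continuous image of that
  space.\<close>

lemma compact_UNIV_vec:
  assumes "compact (UNIV :: 'a::topological_space set)"
  shows "compact (UNIV :: ('a ^ 'n::finite) set)"
proof -
  have "compact_space (product_topology (\<lambda>_::'n. euclidean :: 'a topology) UNIV)"
    using assms by (subst compact_space_product_topology) (simp add: compact_space_def)
  then have "compact (UNIV :: ('n \<Rightarrow> 'a) set)"
    by (simp add: euclidean_product_topology compact_space_def)
  moreover have "continuous_on UNIV (\<lambda>f :: 'n \<Rightarrow> 'a. \<chi> i. f i)"
    by (intro continuous_on_vec_lambda continuous_on_product_coordinates)
  ultimately have "compact (range (\<lambda>f :: 'n \<Rightarrow> 'a. \<chi> i. f i))"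
    by (rule compact_continuous_image[rotated])
  moreover have "range (\<lambda>f :: 'n \<Rightarrow> 'a. \<chi> i. f i) = UNIV"
    by (metis surjI vec_lambda_eta)
  ultimately show ?thesis by simp
qed

lemma open_vec_box: "(\<And>i. open (A i)) \<Longrightarrow> open {x :: 'a::topological_space ^ 'n::finite. \<forall>i. x $ i \<in> A i}"
proof -
  assume "\<And>i. open (A i)"
  then have "open (\<Inter>i. (\<lambda>x :: 'a ^ 'n. x $ i) -` A i)"
    by (intro open_INT ballI open_vimage_vec_nth) auto
  moreover have "(\<Inter>i. (\<lambda>x :: 'a ^ 'n. x $ i) -` A i) = {x. \<forall>i. x $ i \<in> A i}" by auto
  ultimately show ?thesis by simp
qed

lemma regular_vec:
  assumes "compact (UNIV :: 'a::t2_space set)" "open U" "(x :: 'a ^ 'n::finite) \<in> U"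
  shows "\<exists>V C. open V \<and> closed C \<and> x \<in> V \<and> V \<subseteq> C \<and> C \<subseteq> U"
proof -
  obtain A where A: "\<And>i. open (A i)" "\<And>i. x $ i \<in> A i" "\<And>y. (\<forall>i. y $ i \<in> A i) \<Longrightarrow> y \<in> U"
    using assms(2,3) unfolding open_vec_def by metis
  have "\<forall>i. \<exists>V C. open V \<and> closed C \<and> x $ i \<in> V \<and> V \<subseteq> C \<and> C \<subseteq> A i"
    using regular_compact_t2[OF assms(1) A(1,2)] by metis
  then obtain V C where VC: "\<And>i. open (V i)" "\<And>i. closed (C i)" "\<And>i. x $ i \<in> V i"
    "\<And>i. V i \<subseteq> C i" "\<And>i. C i \<subseteq> A i"
    by metis
  have "closed {x :: 'a ^ 'n. \<forall>i. x $ i \<in> C i}"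
  proof -
    have "{x :: 'a ^ 'n. \<forall>i. x $ i \<in> C i} = (\<Inter>i. (\<lambda>x. x $ i) -` C i)" by auto
    then show ?thesis
      using VC(2) by (auto intro!: closed_INT closed_vimage continuous_on_component)
  qed
  moreover have "open {x :: 'a ^ 'n. \<forall>i. x $ i \<in> V i}"
    by (rule open_vec_box) (rule VC)
  ultimately show ?thesis
    using VC A
    by (intro exI[of _ "{x. \<forall>i. x $ i \<in> V i}"] exI[of _ "{x. \<forall>i. x $ i \<in> C i}"]) blast
qed

text \<open>The points are chosen one after the other. Each must avoid finitely many lines (or
  points) through the earlier ones, which are negligible in dimension at least 2, whereas a nonempty
  open set is not. The case \<open>k = 0\<close> makes the \<open>w j\<close> pairwise
  distinct.\<close>

lemma exists_generic_configuration:
  fixes K :: "'n::finite \<Rightarrow> 'v::euclidean_space set"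
  assumes dim: "2 \<le> DIM('v)" and K: "\<And>j. interior (K j) \<noteq> {}"
  obtains w where "\<And>j. w j \<in> interior (K j)"
    and "\<And>i j k. i \<noteq> j \<Longrightarrow> w i - w j \<noteq> k *\<^sub>R (u i - u j)"
    and "\<And>i j k. i \<noteq> j \<Longrightarrow> w i - w j \<noteq> k *\<^sub>R (v i - v j)"
proof -
  define P where "P A w \<longleftrightarrow> (\<forall>j\<in>A. w j \<in> interior (K j)) \<and>
    (\<forall>i\<in>A. \<forall>j\<in>A. i \<noteq> j \<longrightarrow> (\<forall>k. w i - w j \<noteq> k *\<^sub>R (u i - u j) \<and> w i - w j \<noteq> k *\<^sub>R (v i - v j)))" for A w
  have "\<exists>w. P A w" if "finite A" for A :: "'n set"
    using that
  proof (induction A rule: finite_induct)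
    case (insert j A)
    obtain w where w: "P A w" using insert.IH by blast
    let ?N = "\<Union>i\<in>A. (+) (w i) ` (span {u j - u i}) \<union> (+) (w i) ` (span {v j - v i})"
    have "negligible ?N"
    proof -
      have "negligible (span {x} :: 'v set)" for x :: 'v
        using dim dim_le_card'[of "{x}"] by (intro negligible_lowdim) simp
      then show ?thesis
        using \<open>finite A\<close> by (intro negligible_Union) (auto intro!: negligible_Un negligible_translation)
    qed
    then have "\<not> interior (K j) \<subseteq> ?N"
      using negligible_subset[of ?N "interior (K j)"] open_not_negligible[OF open_interior K[of j]] by argo
    then obtain y where y: "y \<in> interior (K j)" "y \<notin> ?N" by blast
    have yA: "y - w i \<noteq> k *\<^sub>R (u j - u i)" "y - w i \<noteq> k *\<^sub>R (v j - v i)" if "i \<in> A" for i k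
    proof -
      have "y \<noteq> w i + k *\<^sub>R (u j - u i)" "y \<noteq> w i + k *\<^sub>R (v j - v i)"
        using y(2) that by (auto simp: span_singleton image_iff)
      then show "y - w i \<noteq> k *\<^sub>R (u j - u i)" "y - w i \<noteq> k *\<^sub>R (v j - v i)"
        by (auto simp: algebra_simps)
    qed
    have yA': "w i - y \<noteq> k *\<^sub>R (u i - u j)" "w i - y \<noteq> k *\<^sub>R (v i - v j)" if "i \<in> A" for i k
    proof -
      have "- (y - w i) \<noteq> - (k *\<^sub>R (u j - u i))" "- (y - w i) \<noteq> - (k *\<^sub>R (v j - v i))"
        using yA[OF that, of k] by (simp_all only: neg_equal_iff_equal not_False_eq_True)
      then show "w i - y \<noteq> k *\<^sub>R (u i - u j)" "w i - y \<noteq> k *\<^sub>R (v i - v j)"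
        by (simp_all flip: scaleR_minus_right)
    qed
    have "P (insert j A) (w(j := y))"
      using w y(1) yA yA' \<open>j \<notin> A\<close> by (auto simp: P_def)
    then show ?case by blast
  qed (simp add: P_def)
  from this[of UNIV] obtain w where "P UNIV w" by auto
  then show ?thesis by (intro that[of w]) (simp_all add: P_def)
qed

text \<open>In the convex square one side is homotopic to the detour along the other three. If
  \<open>Q (t, 0) = Q (t, 1)\<close> for all \<open>t\<close>, this is the familiar fact that freely
  homotopic loops are conjugate along the trace of the base point.\<close>

lemma homotopic_paths_square:
  fixes Q :: "real \<times> real \<Rightarrow> 'b::topological_space"
  assumes Q: "continuous_on ({0..1} \<times> {0..1}) Q" "Q ` ({0..1} \<times> {0..1}) \<subseteq> S"
  shows "homotopic_paths S (\<lambda>s. Q (0, s))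
    ((\<lambda>t. Q (t, 0)) +++ (\<lambda>s. Q (1, s)) +++ reversepath (\<lambda>t. Q (t, 1)))"
proof -
  let ?a = "linepath (0, 0) (0, 1) :: real \<Rightarrow> real \<times> real"
  let ?b1 = "linepath (0, 0) (1, 0) :: real \<Rightarrow> real \<times> real"
  let ?b2 = "linepath (1, 0) (1, 1) :: real \<Rightarrow> real \<times> real"
  let ?b3 = "linepath (1, 1) (0, 1) :: real \<Rightarrow> real \<times> real"
  let ?T = "{0..1} \<times> {0..1} :: (real \<times> real) set"
  have T: "convex ?T" by (intro convex_Times) auto
  have seg: "path_image (linepath x y) \<subseteq> ?T" if "x \<in> ?T" "y \<in> ?T" for x y
    unfolding path_image_linepath using closed_segment_subset[OF that T] .
  have "homotopic_paths S (Q \<circ> ?a) (Q \<circ> (?b1 +++ ?b2 +++ ?b3))"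
  proof (rule homotopic_paths_compose_convex[OF T Q])
    show "path_image ?a \<subseteq> ?T" by (intro seg) auto
    show "path_image (?b1 +++ ?b2 +++ ?b3) \<subseteq> ?T" by (intro subset_path_image_join seg) auto
  qed auto
  moreover have "Q \<circ> ?a = (\<lambda>s. Q (0, s))" "Q \<circ> ?b1 = (\<lambda>t. Q (t, 0))" "Q \<circ> ?b2 = (\<lambda>s. Q (1, s))"
    "Q \<circ> ?b3 = reversepath (\<lambda>t. Q (t, 1))"
    by (auto simp: linepath_def reversepath_def fun_eq_iff)
  ultimately show ?thesis
    by (simp add: path_compose_join)
qed

lemma path_of_continuous_square:
  fixes Q :: "real \<times> real \<Rightarrow> 'b::topological_space"
  assumes "continuous_on ({0..1} \<times> {0..1}) Q" "Q ` ({0..1} \<times> {0..1}) \<subseteq> S" "c \<in> {0..1}"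
  shows "path (\<lambda>s. Q (c, s))" "path_image (\<lambda>s. Q (c, s)) \<subseteq> S"
    "path (\<lambda>s. Q (s, c))" "path_image (\<lambda>s. Q (s, c)) \<subseteq> S"
proof -
  have "continuous_on {0..1} (\<lambda>s. Q (c, s))" "continuous_on {0..1} (\<lambda>s. Q (s, c))"
    using assms(3) by (intro continuous_on_compose2[OF assms(1)] continuous_intros; auto)+
  then show "path (\<lambda>s. Q (c, s))" "path_image (\<lambda>s. Q (c, s)) \<subseteq> S"
    "path (\<lambda>s. Q (s, c))" "path_image (\<lambda>s. Q (s, c)) \<subseteq> S"
    using assms(2,3) by (auto simp: path_def path_image_def)
qed

section \<open>Configurations in products of convex cells\<close>

lemma mem_conf: "x \<in> conf X \<longleftrightarrow> (\<forall>i. x $ i \<in> X) \<and> (\<forall>i j. i \<noteq> j \<longrightarrow> x $ i \<noteq> x $ j)"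
  by (auto simp: conf_def inj_def)

text \<open>A product of open cells \<open>B (r j)\<close> which are pairwise equal or disjoint, each identified with a
  convex set \<open>K (r j)\<close>. The index \<open>r j\<close> names the cluster to which the \<open>j\<close>-th point belongs.\<close>

locale convex_cells =
  fixes r :: "'n::finite \<Rightarrow> 'c"
    and K :: "'c \<Rightarrow> 'v::euclidean_space set"
    and B :: "'c \<Rightarrow> 'a::topological_space set"
    and \<theta> :: "'c \<Rightarrow> 'v \<Rightarrow> 'a" and \<kappa> :: "'c \<Rightarrow> 'a \<Rightarrow> 'v"
  assumes dim: "2 \<le> DIM('v)"
    and cell: "\<And>j. homeomorphism (K (r j)) (B (r j)) (\<theta> (r j)) (\<kappa> (r j))"
    and convex: "\<And>j. convex (K (r j))" and bounded: "\<And>j. bounded (K (r j))"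
    and interior: "\<And>j. interior (K (r j)) \<noteq> {}"
    and disj: "\<And>i j. r i \<noteq> r j \<Longrightarrow> B (r i) \<inter> B (r j) = {}"
begin

definition confs :: "('a ^ 'n) set" where
  "confs = {x. \<forall>j. x $ j \<in> B (r j)} \<inter> conf UNIV"

definition place :: "('n \<Rightarrow> 'v) \<Rightarrow> 'a ^ 'n" where
  "place u = (\<chi> j. \<theta> (r j) (u j))"

definition coords :: "'a ^ 'n \<Rightarrow> 'n \<Rightarrow> 'v" where
  "coords x j = \<kappa> (r j) (x $ j)"

lemma \<theta>_in: "y \<in> K (r j) \<Longrightarrow> \<theta> (r j) y \<in> B (r j)"
  using cell[of j] by (auto simp: homeomorphism_def)

lemma \<kappa>_\<theta>: "y \<in> K (r j) \<Longrightarrow> \<kappa> (r j) (\<theta> (r j) y) = y"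
  using cell[of j] by (auto simp: homeomorphism_def)

lemma \<kappa>_in: "y \<in> B (r j) \<Longrightarrow> \<kappa> (r j) y \<in> K (r j)"
  using cell[of j] by (auto simp: homeomorphism_def)

lemma \<theta>_\<kappa>: "y \<in> B (r j) \<Longrightarrow> \<theta> (r j) (\<kappa> (r j) y) = y"
  using cell[of j] by (auto simp: homeomorphism_def)

text \<open>Collisions can only happen within a cluster, because different clusters occupy disjoint
  cells.\<close>

lemma place_in:
  assumes u: "\<And>j. u j \<in> K (r j)" and inj: "\<And>i j. i \<noteq> j \<Longrightarrow> r i = r j \<Longrightarrow> u i \<noteq> u j"
  shows "place u \<in> confs"
proof -
  have "\<theta> (r i) (u i) \<noteq> \<theta> (r j) (u j)" if "i \<noteq> j" for i j
  proof (cases "r i = r j")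
    case True
    then show ?thesis using inj[OF that True] u[of i] u[of j] \<kappa>_\<theta> by metis
  next
    case False
    then show ?thesis using disj[OF False] \<theta>_in[OF u, of i] \<theta>_in[OF u, of j] by auto
  qed
  then show ?thesis
    using \<theta>_in[OF u] by (auto simp: confs_def mem_conf place_def)
qed

lemma coords_in: "x \<in> confs \<Longrightarrow> coords x j \<in> K (r j)"
  by (simp add: confs_def coords_def \<kappa>_in)

lemma coords_inj: "x \<in> confs \<Longrightarrow> i \<noteq> j \<Longrightarrow> r i = r j \<Longrightarrow> coords x i \<noteq> coords x j"
proof
  assume x: "x \<in> confs" and ij: "i \<noteq> j" "r i = r j" and eq: "coords x i = coords x j"
  have "x $ i = \<theta> (r i) (coords x i)" "x $ j = \<theta> (r j) (coords x j)"
    using x by (simp_all add: confs_def coords_def \<theta>_\<kappa>)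
  then have "x $ i = x $ j" using eq ij(2) by simp
  moreover have "x $ i \<noteq> x $ j" using x ij(1) by (simp add: confs_def mem_conf)
  ultimately show False by simp
qed

lemma place_coords: "x \<in> confs \<Longrightarrow> place (coords x) = x"
  by (simp add: confs_def coords_def place_def \<theta>_\<kappa> vec_eq_iff)

lemma continuous_on_place:
  assumes "\<And>j. continuous_on T (\<lambda>t. u t j)" "\<And>t j. t \<in> T \<Longrightarrow> u t j \<in> K (r j)"
  shows "continuous_on T (\<lambda>t. place (u t))"
  unfolding place_def
proof (rule continuous_on_vec_lambda)
  fix j
  have "continuous_on (K (r j)) (\<theta> (r j))" using cell[of j] by (simp add: homeomorphism_def)
  then show "continuous_on T (\<lambda>t. \<theta> (r j) (u t j))"
    by (rule continuous_on_compose2) (use assms in auto)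
qed

lemma continuous_on_coords:
  assumes "continuous_on T p" "p ` T \<subseteq> confs"
  shows "continuous_on T (\<lambda>t. coords (p t) j)"
proof -
  have "continuous_on (B (r j)) (\<kappa> (r j))" using cell[of j] by (simp add: homeomorphism_def)
  then show ?thesis
    unfolding coords_def
    by (rule continuous_on_compose2) (use assms in \<open>auto intro!: continuous_on_component simp: confs_def\<close>)
qed

lemma confs_nonempty: "confs \<noteq> {}"
proof -
  \<comment> \<open>With both reference configurations zero, genericity amounts to pairwise distinct
    points.\<close>
  obtain w where w: "\<And>j. w j \<in> interior (K (r j))" "\<And>i j k. i \<noteq> j \<Longrightarrow> w i - w j \<noteq> k *\<^sub>R (0 - 0 :: 'v)"
    by (rule exists_generic_configuration[where K = "\<lambda>j. K (r j)" and u = "\<lambda>_. 0" and v = "\<lambda>_. 0",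
        OF dim interior], rule that)
  then have "place w \<in> confs"
    using interior_subset by (intro place_in) fastforce+
  then show ?thesis by auto
qed

text \<open>Both configurations are joined by straight lines to a third one, whose differences avoid the
  finitely many lines that would allow a collision.\<close>

lemma path_connected_confs: "path_connected confs"
  unfolding path_connected_def
proof (intro ballI)
  fix x y assume xy: "x \<in> confs" "y \<in> confs"
  obtain w where w: "\<And>j. w j \<in> interior (K (r j))"
    and wx: "\<And>i j k. i \<noteq> j \<Longrightarrow> w i - w j \<noteq> k *\<^sub>R (coords x i - coords x j)"
    and wy: "\<And>i j k. i \<noteq> j \<Longrightarrow> w i - w j \<noteq> k *\<^sub>R (coords y i - coords y j)"
    by (rule exists_generic_configuration[where K = "\<lambda>j. K (r j)" and u = "coords x" and v = "coords y",
        OF dim interior], rule that)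
  have *: "\<exists>p. path p \<and> path_image p \<subseteq> confs \<and> pathstart p = x \<and> pathfinish p = place w"
    if x: "x \<in> confs" and wx: "\<And>i j k. i \<noteq> j \<Longrightarrow> w i - w j \<noteq> k *\<^sub>R (coords x i - coords x j)" for x
  proof -
    let ?u = "\<lambda>t j. (1 - t) *\<^sub>R coords x j + t *\<^sub>R w j"
    have K: "?u t j \<in> K (r j)" if "t \<in> {0..1}" for t j
      using that convexD[OF convex[of j] coords_in[OF x, of j], of "w j" "1 - t" t] w[of j]
        interior_subset by force
    have "?u t i \<noteq> ?u t j" if t: "t \<in> {0..1}" and ij: "i \<noteq> j" "r i = r j" for t i j
    proof
      assume eq: "?u t i = ?u t j"
      show False
      proof (cases "t = 0")
        case True
        then show False using eq coords_inj[OF x ij] by simp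
      next
        case False
        \<comment> \<open>Solving a collision for the difference of the end points puts it on the
          line that \<open>w\<close> was chosen to avoid.\<close>
        have "t *\<^sub>R (w i - w j) = - ((1 - t) *\<^sub>R (coords x i - coords x j))"
          using eq by (simp add: algebra_simps)
        then have "(1 / t) *\<^sub>R (t *\<^sub>R (w i - w j)) = (1 / t) *\<^sub>R (- ((1 - t) *\<^sub>R (coords x i - coords x j)))"
          by simp
        then have "w i - w j = (- ((1 - t) / t)) *\<^sub>R (coords x i - coords x j)"
          using False by simp
        then show False using wx[OF ij(1)] by blast
      qed
    qed
    then have "place (?u t) \<in> confs" if "t \<in> {0..1}" for t
      using K that by (intro place_in) auto
    moreover have "continuous_on {0..1} (\<lambda>t. place (?u t))"
      by (rule continuous_on_place) (use K in \<open>auto intro!: continuous_intros\<close>)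
    ultimately show ?thesis
      by (intro exI[of _ "\<lambda>t. place (?u t)"])
        (auto simp: path_def path_image_def pathstart_def pathfinish_def place_coords[OF x])
  qed
  obtain p where p: "path p" "path_image p \<subseteq> confs" "pathstart p = x" "pathfinish p = place w"
    using *[OF xy(1) wx] by blast
  obtain q where q: "path q" "path_image q \<subseteq> confs" "pathstart q = y" "pathfinish q = place w"
    using *[OF xy(2) wy] by blast
  show "\<exists>g. path g \<and> path_image g \<subseteq> confs \<and> pathstart g = x \<and> pathfinish g = y"
    using p q by (intro exI[of _ "p +++ reversepath q"]) (auto simp: path_image_join)
qed

text \<open>Each cluster is contracted by a homothety towards a point of its cell.\<close>

lemma loop_homotopic_into:
  assumes U: "open U" "\<And>j. B (r j) \<inter> U \<noteq> {}"
    and p: "path p" "path_image p \<subseteq> confs" "pathfinish p = pathstart p"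
  obtains q p' where "path q" "path_image q \<subseteq> confs" "path p'" "path_image p' \<subseteq> confs \<inter> conf U"
    "pathfinish q = pathstart p'" "pathfinish p' = pathstart p'"
    "homotopic_paths confs p (q +++ p' +++ reversepath q)"
proof -
  have "\<exists>a \<epsilon>. a \<in> K (r j) \<and> 0 < \<epsilon> \<and> \<epsilon> \<le> 1 \<and>
      (\<forall>y\<in>K (r j). a + \<epsilon> *\<^sub>R (y - a) \<in> K (r j) \<and> \<theta> (r j) (a + \<epsilon> *\<^sub>R (y - a)) \<in> U)" for j
  proof -
    let ?K = "K (r j)"
    obtain b where b: "b \<in> B (r j)" "b \<in> U" using U(2)[of j] by auto
    define a0 where "a0 = \<kappa> (r j) b"
    have a0: "a0 \<in> ?K" "\<theta> (r j) a0 \<in> U" using b by (auto simp: a0_def \<kappa>_in \<theta>_\<kappa>)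
    have "continuous_on ?K (\<theta> (r j))" using cell[of j] by (simp add: homeomorphism_def)
    then obtain N where N: "open N" "N \<inter> ?K = \<theta> (r j) -` U \<inter> ?K"
      using U(1) unfolding continuous_on_open_invariant by metis
    \<comment> \<open>The point \<open>a0\<close> over \<open>U\<close> may lie on the boundary of
      the model cell, so the centre is moved to a nearby interior point \<open>a\<close>, around
      which a whole ball is mapped into \<open>U\<close>.\<close>
    have "a0 \<in> closure (interior ?K)"
      using convex_closure_interior[OF convex interior] a0(1) closure_subset by blast
    moreover have "a0 \<in> N" using N a0 by auto
    ultimately obtain a where a: "a \<in> N" "a \<in> interior ?K"
      using N(1) by (metis IntE equals0I open_Int_closure_eq_empty IntI)
    then have "a \<in> N \<inter> interior ?K" "open (N \<inter> interior ?K)" using N by auto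
    then obtain e where e: "e > 0" "ball a e \<subseteq> N \<inter> interior ?K"
      using openE by blast
    obtain R where R: "R > 0" "\<And>y. y \<in> ?K \<Longrightarrow> norm y \<le> R"
      using bounded[of j] by (auto simp: bounded_pos)
    have aK: "a \<in> ?K" using a interior_subset by blast
    \<comment> \<open>Points of the cell have distance at most \<open>2 * R\<close> from
      \<open>a\<close>, so this factor shrinks the cell to radius at most
      \<open>e / 2\<close>.\<close>
    define \<epsilon> where "\<epsilon> = min 1 (e / (4 * R))"
    have \<epsilon>: "0 < \<epsilon>" "\<epsilon> \<le> 1" "\<epsilon> * (4 * R) \<le> e"
      using e R by (auto simp: \<epsilon>_def min_def field_simps)
    have "a + \<epsilon> *\<^sub>R (y - a) \<in> ball a e" if y: "y \<in> ?K" for y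
    proof -
      have "norm (y - a) \<le> 2 * R"
        using norm_triangle_ineq4[of y a] R(2)[OF y] R(2)[OF aK] by simp
      then have "\<epsilon> * norm (y - a) \<le> \<epsilon> * (2 * R)" using \<epsilon> by simp
      also have "\<dots> < e" using \<epsilon> e R by (simp add: mult.assoc[symmetric])
      finally show ?thesis using \<epsilon> by (simp add: dist_norm)
    qed
    then have "a + \<epsilon> *\<^sub>R (y - a) \<in> ?K \<and> \<theta> (r j) (a + \<epsilon> *\<^sub>R (y - a)) \<in> U" if "y \<in> ?K" for y
      using e(2) N(2) interior_subset[of ?K] that by blast
    then show ?thesis using aK \<epsilon> by blast
  qed
  \<comment> \<open>Centre and factor are chosen per cluster, not per point: points sharing a cell
    must undergo the same homothety, which is injective and so prevents collisions.\<close>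
  then have "\<forall>c\<in>range r. \<exists>a \<epsilon>. a \<in> K c \<and> 0 < \<epsilon> \<and> \<epsilon> \<le> 1 \<and>
      (\<forall>y\<in>K c. a + \<epsilon> *\<^sub>R (y - a) \<in> K c \<and> \<theta> c (a + \<epsilon> *\<^sub>R (y - a)) \<in> U)"
    by blast
  then obtain a \<epsilon> where a: "\<And>j. a (r j) \<in> K (r j)" and \<epsilon>: "\<And>j. 0 < \<epsilon> (r j)" "\<And>j. \<epsilon> (r j) \<le> (1::real)"
    and in_U: "\<And>j y. y \<in> K (r j) \<Longrightarrow> \<theta> (r j) (a (r j) + \<epsilon> (r j) *\<^sub>R (y - a (r j))) \<in> U"
    by (metis rangeI)
  \<comment> \<open>The factor runs linearly from 1 down to \<open>\<epsilon> (r j)\<close> and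
    stays positive, so every stage is injective on each cluster.\<close>
  define \<sigma> where "\<sigma> t j = 1 - t * (1 - \<epsilon> (r j))" for t j
  define u where "u t s j = a (r j) + \<sigma> t j *\<^sub>R (coords (p s) j - a (r j))" for t s j
  define Q where "Q = (\<lambda>(t, s). place (u t s))"
  have pc: "p s \<in> confs" if "s \<in> {0..1}" for s
    using p(2) that by (auto simp: path_image_def)
  have \<sigma>: "0 < \<sigma> t j" "\<sigma> t j \<le> 1" if "t \<in> {0..1}" for t j
  proof -
    have "t * (1 - \<epsilon> (r j)) \<le> 1 * (1 - \<epsilon> (r j))" "0 \<le> t * (1 - \<epsilon> (r j))"
      using that \<epsilon>[of j] by (intro mult_right_mono mult_nonneg_nonneg; simp)+
    then show "0 < \<sigma> t j" "\<sigma> t j \<le> 1" using \<epsilon>(1)[of j] by (auto simp: \<sigma>_def)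
  qed
  have uK: "u t s j \<in> K (r j)" if "t \<in> {0..1}" "s \<in> {0..1}" for t s j
  proof -
    have "(1 - \<sigma> t j) *\<^sub>R a (r j) + \<sigma> t j *\<^sub>R coords (p s) j \<in> K (r j)"
      using \<sigma>[of t j] that by (intro convexD[OF convex] a coords_in pc) auto
    then show ?thesis by (simp add: u_def algebra_simps)
  qed
  have "Q ts \<in> confs" if sq: "ts \<in> {0..1} \<times> {0..1}" for ts
  proof -
    obtain t s where ts: "ts = (t, s)" "t \<in> {0..1}" "s \<in> {0..1}" using sq by auto
    have "u t s i \<noteq> u t s j" if "i \<noteq> j" "r i = r j" for i j
      using coords_inj[OF pc[OF ts(3)] that] \<sigma>(1)[OF ts(2), of j] that(2)
      by (auto simp: u_def \<sigma>_def)
    then show ?thesis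
      using uK ts by (auto simp: Q_def intro!: place_in)
  qed
  then have Qim: "Q ` ({0..1} \<times> {0..1}) \<subseteq> confs" by auto
  have Qcont: "continuous_on ({0..1} \<times> {0..1}) Q"
    unfolding Q_def case_prod_unfold
  proof (rule continuous_on_place)
    fix j
    have "continuous_on {0..1} (\<lambda>s. coords (p s) j)"
      by (rule continuous_on_coords) (use p in \<open>auto simp: path_def path_image_def\<close>)
    then have "continuous_on ({0..1} \<times> {0..1}) (\<lambda>x :: real \<times> real. coords (p (snd x)) j)"
      by (rule continuous_on_compose2) (auto intro!: continuous_intros)
    then show "continuous_on ({0..1} \<times> {0..1}) (\<lambda>x. u (fst x) (snd x) j)"
      unfolding u_def \<sigma>_def by (intro continuous_intros)
  qed (use uK in auto)
  \<comment> \<open>As \<open>p\<close> is closed, both horizontal sides of the square agree; they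
    become the conjugating path \<open>q\<close> and its reverse.\<close>
  have ends: "Q (t, 1) = Q (t, 0)" for t
  proof -
    have "u t 1 = u t 0" using p(3) by (simp add: u_def fun_eq_iff pathfinish_def pathstart_def)
    then show ?thesis by (simp add: Q_def)
  qed
  have Q0: "Q (0, s) = p s" if "s \<in> {0..1}" for s
  proof -
    have "u 0 s = coords (p s)" by (simp add: u_def \<sigma>_def fun_eq_iff)
    then show ?thesis using place_coords[OF pc[OF that]] by (simp add: Q_def)
  qed
  have "homotopic_paths confs p (\<lambda>s. Q (0, s))"
    using p Q0 by (intro homotopic_paths_eq) auto
  also have "homotopic_paths confs \<dots>
      ((\<lambda>t. Q (t, 0)) +++ (\<lambda>s. Q (1, s)) +++ reversepath (\<lambda>t. Q (t, 0)))"
    using homotopic_paths_square[OF Qcont Qim] by (simp add: ends)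
  finally have h: "homotopic_paths confs p
      ((\<lambda>t. Q (t, 0)) +++ (\<lambda>s. Q (1, s)) +++ reversepath (\<lambda>t. Q (t, 0)))" .
  have "Q (1, s) \<in> conf U" if "s \<in> {0..1}" for s
  proof -
    have "Q (1, s) \<in> confs" using Qim that by auto
    moreover have "Q (1, s) $ j \<in> U" for j
      using in_U[OF coords_in[OF pc[OF that], of j]] by (simp add: Q_def place_def u_def \<sigma>_def)
    ultimately show ?thesis by (auto simp: confs_def mem_conf)
  qed
  then have "path_image (\<lambda>s. Q (1, s)) \<subseteq> confs \<inter> conf U"
    using path_of_continuous_square(2)[OF Qcont Qim, of 1] by (auto simp: path_image_def)
  then show ?thesis
    using h path_of_continuous_square[OF Qcont Qim]
    by (intro that[of "\<lambda>t. Q (t, 0)" "\<lambda>s. Q (1, s)"]) (auto simp: pathstart_def pathfinish_def ends)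
qed

text \<open>A single point cannot collide with another, so the straight-line contraction to the
  start, available in a convex cell, stays among the configurations. This serves the case of
  dimension at least 3.\<close>

lemma loop_null_homotopic_single:
  assumes "CARD('n) = 1" and p: "path p" "path_image p \<subseteq> confs" "pathfinish p = pathstart p"
  shows "homotopic_paths confs p (\<lambda>_. pathstart p)"
proof -
  have pc: "p s \<in> confs" if "s \<in> {0..1}" for s
    using p(2) that by (auto simp: path_image_def)
  define u where "u t s j = (1 - t) *\<^sub>R coords (p s) j + t *\<^sub>R coords (p 0) j" for t s j
  define Q where "Q = (\<lambda>(t, s). place (u t s))"
  have single: "i = j" for i j :: 'n
    using assms(1) by (metis UNIV_I card_1_singletonE singletonD)
  have uK: "u t s j \<in> K (r j)" if "t \<in> {0..1}" "s \<in> {0..1}" for t s j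
    unfolding u_def using that by (intro convexD[OF convex] coords_in pc) auto
  then have Qim: "Q ` ({0..1} \<times> {0..1}) \<subseteq> confs"
    using single by (auto simp: Q_def intro!: place_in)
  have Qcont: "continuous_on ({0..1} \<times> {0..1}) Q"
    unfolding Q_def case_prod_unfold
  proof (rule continuous_on_place)
    fix j
    have "continuous_on {0..1} (\<lambda>s. coords (p s) j)"
      by (rule continuous_on_coords) (use p in \<open>auto simp: path_def path_image_def\<close>)
    then have "continuous_on ({0..1} \<times> {0..1}) (\<lambda>x :: real \<times> real. coords (p (snd x)) j)"
      by (rule continuous_on_compose2) (auto intro!: continuous_intros)
    then show "continuous_on ({0..1} \<times> {0..1}) (\<lambda>x. u (fst x) (snd x) j)"
      unfolding u_def by (intro continuous_intros)
  qed (use uK in auto)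
  have p0: "p 1 = p 0" "pathstart p = p 0" using p(3) by (auto simp: pathstart_def pathfinish_def)
  have c: "place (coords (p 0)) = p 0" by (rule place_coords[OF pc]) simp
  have Q: "Q (t, 0) = p 0" "Q (t, 1) = p 0" "Q (1, t) = p 0" for t
  proof -
    have "u t 0 = coords (p 0)" "u t 1 = coords (p 0)" "u 1 t = coords (p 0)"
      using p0 by (auto simp: u_def fun_eq_iff simp flip: scaleR_left_distrib)
    then show "Q (t, 0) = p 0" "Q (t, 1) = p 0" "Q (1, t) = p 0"
      using c by (simp_all add: Q_def)
  qed
  have Q0: "Q (0, s) = p s" if "s \<in> {0..1}" for s
  proof -
    have "u 0 s = coords (p s)" by (simp add: u_def fun_eq_iff)
    then show ?thesis using place_coords[OF pc[OF that]] by (simp add: Q_def)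
  qed
  have "homotopic_paths confs p (\<lambda>s. Q (0, s))"
    using p Q0 by (intro homotopic_paths_eq) auto
  also have "homotopic_paths confs \<dots> (\<lambda>_. p 0)"
    \<comment> \<open>The three remaining sides of the square are constant at
      \<open>p 0\<close>.\<close>
    using homotopic_paths_square[OF Qcont Qim] by (simp add: Q reversepath_def joinpaths_def)
  finally show ?thesis using p0 by simp
qed

end

section \<open>Cells in manifolds\<close>

text \<open>A small ball around the image of \<open>x\<close>, cut with the chart image, is a ball
  or a ball intersected with a half-space, depending on the kind of chart; in both cases it is
  convex and bounded. For a boundary point the centre need not be interior, but interior points
  exist, and the cell is still open in the manifold.\<close>

lemma chart_cell:
  fixes A :: "('a::topological_space, 'm::finite) chart set"
  assumes A: "oriented_smooth_atlas A" and O: "open O'" "x \<in> O'"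
  obtains U \<psi> K where "(U, \<psi>) \<in> A" "K \<subseteq> \<psi> ` U" "open {y \<in> U. \<psi> y \<in> K}" "x \<in> U" "\<psi> x \<in> K"
    "{y \<in> U. \<psi> y \<in> K} \<subseteq> O'" "homeomorphism K {y \<in> U. \<psi> y \<in> K} (inv_into U \<psi>) \<psi>"
    "convex K" "bounded K" "interior K \<noteq> {}"
proof -
  have "x \<in> (\<Union>c\<in>A. fst c)" using A by (simp add: oriented_smooth_atlas_def)
  then obtain U \<psi> where c: "(U, \<psi>) \<in> A" "x \<in> U" by force
  have "is_chart (U, \<psi>)" using A c(1) by (simp add: oriented_smooth_atlas_def)
  then have U: "open U" "homeomorphism U (\<psi> ` U) \<psi> (inv_into U \<psi>)" "model_open (\<psi> ` U)"
    by (simp_all add: is_chart_def)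
  have "openin (top_of_set U) (U \<inter> O')"
    using O(1) by (simp add: openin_open_Int)
  then have "openin (top_of_set (\<psi> ` U)) (\<psi> ` (U \<inter> O'))"
    by (rule homeomorphism_imp_open_map[OF U(2)])
  then obtain N where N: "open N" "\<psi> ` (U \<inter> O') = \<psi> ` U \<inter> N"
    by (auto simp: openin_open)
  obtain e where e: "e > 0" "ball (\<psi> x) e \<subseteq> N" "convex (ball (\<psi> x) e \<inter> \<psi> ` U)"
    "interior (ball (\<psi> x) e \<inter> \<psi> ` U) \<noteq> {}"
  proof -
    have xN: "\<psi> x \<in> N" using N c O(2) by blast
    consider "open (\<psi> ` U)" | i where "openin (top_of_set {y. 0 \<le> y $ i}) (\<psi> ` U)"
      using U(3) unfolding model_open_def by blast
    then show ?thesis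
    proof cases
      case 1
      then have "open (N \<inter> \<psi> ` U)" "\<psi> x \<in> N \<inter> \<psi> ` U" using N xN c by auto
      then obtain e where e: "e > 0" "ball (\<psi> x) e \<subseteq> N \<inter> \<psi> ` U" using openE by blast
      then have "ball (\<psi> x) e \<inter> \<psi> ` U = ball (\<psi> x) e" by auto
      then show ?thesis using e by (intro that[of e]) (auto simp: interior_open)
    next
      case 2
      then obtain V where V: "open V" "\<psi> ` U = {y. 0 \<le> y $ i} \<inter> V" by (auto simp: openin_open)
      then have "open (N \<inter> V)" "\<psi> x \<in> N \<inter> V" using N xN c by auto
      then obtain e where e: "e > 0" "ball (\<psi> x) e \<subseteq> N \<inter> V" using openE by blast
      have eq: "ball (\<psi> x) e \<inter> \<psi> ` U = ball (\<psi> x) e \<inter> {y. 0 \<le> y $ i}" using e V by auto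
      have half: "{y :: real ^ 'm. 0 \<le> y $ i} = {y. axis i 1 \<bullet> y \<ge> 0}"
        by (simp add: inner_axis' )
      have "convex (ball (\<psi> x) e \<inter> \<psi> ` U)"
        unfolding eq half by (intro convex_Int convex_ball convex_halfspace_ge)
      \<comment> \<open>Half a radius in the inward direction makes the coordinate \<open>i\<close>
        positive without leaving the ball.\<close>
      moreover have "\<psi> x + (e / 2) *\<^sub>R axis i 1 \<in> interior (ball (\<psi> x) e \<inter> \<psi> ` U)"
      proof (rule interiorI)
        have "open {y :: real ^ 'm. 0 < y $ i}"
          by (intro open_Collect_less continuous_intros)
        then show "open (ball (\<psi> x) e \<inter> {y. 0 < y $ i})" by (intro open_Int) auto
        have "0 \<le> \<psi> x $ i" using V c by auto
        then show "\<psi> x + (e / 2) *\<^sub>R axis i 1 \<in> ball (\<psi> x) e \<inter> {y. 0 < y $ i}"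
          using e(1) by (simp add: dist_norm)
        show "ball (\<psi> x) e \<inter> {y. 0 < y $ i} \<subseteq> ball (\<psi> x) e \<inter> \<psi> ` U" unfolding eq by auto
      qed
      ultimately show ?thesis using e by (intro that[of e]) auto
    qed
  qed
  define K where "K = ball (\<psi> x) e \<inter> \<psi> ` U"
  have inj: "inj_on \<psi> U" using U(2) unfolding homeomorphism_def inj_on_def by metis
  have B: "{y \<in> U. \<psi> y \<in> K} = U \<inter> \<psi> -` ball (\<psi> x) e" by (auto simp: K_def)
  have "continuous_on U \<psi>" using U(2) by (simp add: homeomorphism_def)
  then have "open {y \<in> U. \<psi> y \<in> K}"
    unfolding B using U(1) by (intro continuous_open_preimage) auto
  moreover have "{y \<in> U. \<psi> y \<in> K} \<subseteq> O'"
  proof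
    fix y assume y: "y \<in> {y \<in> U. \<psi> y \<in> K}"
    then have "\<psi> y \<in> \<psi> ` (U \<inter> O')" using N(2) e(2) by (auto simp: K_def)
    then show "y \<in> O'" using inj y by (auto simp: inj_on_def)
  qed
  moreover have "homeomorphism K {y \<in> U. \<psi> y \<in> K} (inv_into U \<psi>) \<psi>"
  proof (rule homeomorphism_of_subsets[OF homeomorphism_symD[OF U(2)]])
    show "K \<subseteq> \<psi> ` U" by (auto simp: K_def)
    then have "inv_into U \<psi> ` K \<subseteq> {y \<in> U. \<psi> y \<in> K}"
      by (auto simp: f_inv_into_f subset_iff intro: inv_into_into)
    moreover have "y \<in> inv_into U \<psi> ` K" if "y \<in> U" "\<psi> y \<in> K" for y
      using that inv_into_f_f[OF inj that(1)] by (metis imageI)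
    ultimately show "inv_into U \<psi> ` K = {y \<in> U. \<psi> y \<in> K}" by blast
  qed auto
  moreover have "\<psi> x \<in> K" using e c by (auto simp: K_def)
  moreover have "bounded K" unfolding K_def using bounded_ball by (rule bounded_subset) auto
  ultimately show ?thesis
    using c e by (intro that[of U \<psi> K]) (auto simp: K_def)
qed

text \<open>Near an interior point \<open>y\<close> of \<open>K\<close> the density agrees on
  \<open>X\<close> with a continuous local extension and hence exceeds half of its value at
  \<open>y\<close>. This happens on a nonempty open set, which has positive Lebesgue
  measure.\<close>

lemma nn_integral_pos_of_continuous_extension:
  fixes \<rho> :: "'v::euclidean_space \<Rightarrow> real"
  assumes K: "interior K \<noteq> {}" "K \<subseteq> X" and \<rho>: "smooth_on X \<rho>" "\<And>y. y \<in> X \<Longrightarrow> \<rho> y > 0"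
  shows "(\<integral>\<^sup>+y\<in>K. ennreal (\<rho> y) \<partial>lborel) > 0"
proof -
  obtain y where y: "y \<in> interior K" using K by auto
  then have yX: "y \<in> X" using K interior_subset by blast
  obtain V g where V: "open V" "y \<in> V" "\<forall>k. Ck_on k V g" "\<forall>w\<in>X \<inter> V. g w = \<rho> w"
    using \<rho>(1) yX unfolding smooth_on_def by metis
  have "continuous_on V g" using V(3)[rule_format, of 0] by simp
  then have "open (V \<inter> g -` {\<rho> y / 2 <..})" using V(1) by (intro continuous_open_preimage) auto
  moreover have "g y = \<rho> y" using V yX by auto
  ultimately have op: "open (interior K \<inter> (V \<inter> g -` {\<rho> y / 2 <..}))"
    and mem: "y \<in> interior K \<inter> (V \<inter> g -` {\<rho> y / 2 <..})"
    using y V \<rho>(2)[OF yX] by auto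
  let ?b = "interior K \<inter> (V \<inter> g -` {\<rho> y / 2 <..})"
  have "\<not> negligible ?b" using open_not_negligible[OF op] mem by blast
  then have "emeasure lborel ?b \<noteq> 0"
    using op null_sets_completionI[of ?b lborel] by (auto simp: negligible_iff_null_sets null_sets_def)
  then have "0 < ennreal (\<rho> y / 2) * emeasure lborel ?b"
    using \<rho>(2)[OF yX] by (simp add: ennreal_zero_less_mult_iff zero_less_iff_neq_zero)
  also have "\<dots> = (\<integral>\<^sup>+w. ennreal (\<rho> y / 2) * indicator ?b w \<partial>lborel)"
    using op by (intro nn_integral_cmult_indicator[symmetric]) auto
  \<comment> \<open>Comparison with a step function works without measurability of the right-hand
    integrand.\<close>
  also have "\<dots> \<le> (\<integral>\<^sup>+w\<in>K. ennreal (\<rho> w) \<partial>lborel)"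
  proof (rule nn_integral_mono)
    fix w
    show "ennreal (\<rho> y / 2) * indicator ?b w \<le> ennreal (\<rho> w) * indicator K w"
    proof (cases "w \<in> ?b")
      case True
      then have "w \<in> K" "w \<in> X" using interior_subset K by blast+
      then have "\<rho> y / 2 \<le> \<rho> w" using True V by auto
      then show ?thesis using \<open>w \<in> K\<close> True by (simp add: ennreal_leI)
    qed simp
  qed
  finally show ?thesis .
qed

text \<open>A nonempty open set contains a chart cell, to which the volume form gives positive
  measure; the complement of \<open>D\<close> is a null set.\<close>

lemma full_measure_imp_dense:
  fixes A :: "('a::topological_space, 'm::finite) chart set"
  assumes A: "oriented_smooth_atlas A" and \<mu>: "prob_space \<mu>" "induced_by_volume_form A \<mu>"
    and D: "measure \<mu> D = 1" and O: "open O'" "O' \<noteq> {}"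
  shows "O' \<inter> D \<noteq> {}"
proof
  assume disj: "O' \<inter> D = {}"
  interpret prob_space \<mu> by fact
  obtain \<rho> where sets: "sets \<mu> = sets borel" and \<rho>: "volume_form A \<rho>"
    and em: "\<And>c B. c \<in> A \<Longrightarrow> B \<in> sets borel \<Longrightarrow> B \<subseteq> fst c \<Longrightarrow>
       emeasure \<mu> B = (\<integral>\<^sup>+x\<in>snd c ` B. ennreal (\<rho> c x) \<partial>lborel)"
    using \<mu>(2) unfolding induced_by_volume_form_def by metis
  obtain x where "x \<in> O'" using O by auto
  obtain U \<psi> K where c: "(U, \<psi>) \<in> A" "K \<subseteq> \<psi> ` U" "open {y \<in> U. \<psi> y \<in> K}" "{y \<in> U. \<psi> y \<in> K} \<subseteq> O'"
    "interior K \<noteq> {}"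
    by (rule chart_cell[OF A O(1) \<open>x \<in> O'\<close>])
  let ?B = "{y \<in> U. \<psi> y \<in> K}"
  have "\<psi> ` ?B = K" using c(2) by auto
  then have "emeasure \<mu> ?B = (\<integral>\<^sup>+x\<in>K. ennreal (\<rho> (U, \<psi>) x) \<partial>lborel)"
    using em[OF c(1), of ?B] c(3) by auto
  also have "\<dots> > 0"
    using \<rho> c(1,2) unfolding volume_form_def
    by (intro nn_integral_pos_of_continuous_extension[OF c(5,2)]) force+
  finally have pos: "emeasure \<mu> ?B > 0" .
  \<comment> \<open>\<open>measure\<close> is 0 on sets that are not measurable, so the value 1
    forces measurability.\<close>
  have D': "D \<in> sets \<mu>" using D measure_notin_sets[of D \<mu>] by force
  have "?B \<in> sets \<mu>" using c(3) sets by auto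
  then have "emeasure \<mu> ?B \<le> emeasure \<mu> (space \<mu> - D)"
    using c(4) disj D' sets.sets_into_space[of ?B \<mu>] by (intro emeasure_mono) auto
  also have "\<dots> = 0"
    using prob_compl[OF D'] D by (simp add: emeasure_eq_measure)
  finally show False using pos by simp
qed

text \<open>The disc lives in a space of sequences; it is closed and lies in a product of compact
  intervals, almost all of them equal to \<open>{0}\<close>.\<close>

lemma compact_cw_disc: "compact (cw_disc d)"
proof -
  let ?S = "\<lambda>i. if i < d then {-1..1} else {0 :: real}"
  have "compactin (product_topology (\<lambda>_::nat. euclideanreal) UNIV) (PiE UNIV ?S)"
    unfolding compactin_PiE by simp
  then have "compact (PiE UNIV ?S)"
    by (simp add: euclidean_product_topology)
  moreover have "closed {x :: nat \<Rightarrow> real. (\<forall>i\<ge>d. x i = 0) \<and> (\<Sum>i<d. (x i)\<^sup>2) \<le> 1}"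
    by (intro closed_Collect_conj closed_Collect_all closed_Collect_imp open_Collect_const
        closed_Collect_eq closed_Collect_le continuous_intros continuous_on_product_coordinates)
  moreover have "cw_disc d = {x. (\<forall>i\<ge>d. x i = 0) \<and> (\<Sum>i<d. (x i)\<^sup>2) \<le> 1}"
    by (auto simp: cw_disc_def topspace_Euclidean_space)
  moreover have "cw_disc d \<subseteq> PiE UNIV ?S"
  proof
    fix x assume x: "x \<in> cw_disc d"
    have "\<bar>x i\<bar> \<le> 1" if "i < d" for i
    proof -
      have "(x i)\<^sup>2 \<le> (\<Sum>i<d. (x i)\<^sup>2)"
        using that by (intro member_le_sum) auto
      also have "\<dots> \<le> 1" using x by (simp add: cw_disc_def)
      finally show ?thesis by (simp add: abs_square_le_1)
    qed
    then show "x \<in> PiE UNIV ?S"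
      using x by (auto simp: cw_disc_def topspace_Euclidean_space abs_le_iff minus_le_iff)
  qed
  ultimately have "compact (PiE UNIV ?S \<inter> cw_disc d)" "PiE UNIV ?S \<inter> cw_disc d = cw_disc d"
    by (auto intro: compact_Int_closed)
  then show ?thesis by simp
qed

text \<open>The complement is the union of the finitely many other closed cells: their boundaries
  are attached to cells of still lower dimension, hence never meet \<open>D\<close>. Compact images
  are closed in a Hausdorff space.\<close>

lemma open_unique_top_cell:
  fixes D :: "'a::t2_space set"
  assumes "unique_top_cell m D"
  shows "open D"
proof -
  obtain C \<Phi> where C: "cw_decomposition C" "(m, \<Phi>) \<in> C" "\<forall>c\<in>C. c \<noteq> (m, \<Phi>) \<longrightarrow> fst c < m"
    "D = \<Phi> ` cw_open_disc m"
    using assms unfolding unique_top_cell_def by (elim exE conjE) (rule that)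
  let ?L = "C - {(m, \<Phi>)}"
  note cw = C(1)[unfolded cw_decomposition_def]
  note fin = conjunct1[OF cw] and cover = conjunct1[OF conjunct2[OF cw]]
    and disj = conjunct1[OF conjunct2[OF conjunct2[OF cw]]]
    and attach = conjunct2[OF conjunct2[OF conjunct2[OF cw]]]
  have disj': "\<Psi>' ` cw_open_disc d' \<inter> D = {}" if "(d', \<Psi>') \<in> C" "(d', \<Psi>') \<noteq> (m, \<Phi>)" for d' \<Psi>'
    using bspec[OF disj that(1)] C(2,4) that(2) by fastforce
  have attach': "\<Psi> ` (cw_disc d - cw_open_disc d) \<subseteq> (\<Union>(d', \<Phi>')\<in>{c \<in> C. fst c < d}. \<Phi>' ` cw_open_disc d')"
    "continuous_on (cw_disc d) \<Psi>" if "(d, \<Psi>) \<in> C" for d \<Psi>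
    using bspec[OF attach that] by simp_all
  have "- D = (\<Union>c\<in>?L. snd c ` cw_disc (fst c))"
  proof
    have "x \<in> (\<Union>c\<in>?L. snd c ` cw_disc (fst c))" if x: "x \<notin> D" for x
    proof -
      have "x \<in> (\<Union>(d, \<Phi>)\<in>C. \<Phi> ` cw_open_disc d)" using cover by simp
      then obtain d \<Psi> where "(d, \<Psi>) \<in> C" "x \<in> \<Psi> ` cw_open_disc d" by auto
      moreover have "(d, \<Psi>) \<noteq> (m, \<Phi>)" using x C(4) calculation by auto
      moreover have "cw_open_disc d \<subseteq> cw_disc d" by (auto simp: cw_open_disc_def cw_disc_def)
      ultimately show ?thesis by (intro UN_I[of "(d, \<Psi>)"]) auto
    qed
    then show "- D \<subseteq> (\<Union>c\<in>?L. snd c ` cw_disc (fst c))" by auto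
    have "x \<notin> D" if dP: "(d, \<Psi>) \<in> ?L" and x: "x \<in> \<Psi> ` cw_disc d" for d \<Psi> x
    proof -
      have dC: "(d, \<Psi>) \<in> C" "(d, \<Psi>) \<noteq> (m, \<Phi>)" "d < m" using dP C(3) by auto
      obtain d' \<Psi>' where "(d', \<Psi>') \<in> C" "(d', \<Psi>') \<noteq> (m, \<Phi>)" "x \<in> \<Psi>' ` cw_open_disc d'"
      proof (cases "x \<in> \<Psi> ` cw_open_disc d")
        case True
        then show ?thesis using dC that by blast
      next
        case False
        then have "x \<in> \<Psi> ` (cw_disc d - cw_open_disc d)" using x by auto
        then have "x \<in> (\<Union>(d', \<Phi>')\<in>{c \<in> C. fst c < d}. \<Phi>' ` cw_open_disc d')"
          using attach'(1)[OF dC(1)] by blast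
        then obtain d' \<Psi>' where "(d', \<Psi>') \<in> C" "d' < d" "x \<in> \<Psi>' ` cw_open_disc d'" by auto
        then show ?thesis using that dC(3) by auto
      qed
      then show ?thesis using disj' by blast
    qed
    then show "(\<Union>c\<in>?L. snd c ` cw_disc (fst c)) \<subseteq> - D" by force
  qed
  moreover have "closed (\<Union>c\<in>?L. snd c ` cw_disc (fst c))"
    using fin attach'(2)
    by (intro closed_UN ballI compact_imp_closed compact_continuous_image compact_cw_disc) auto
  ultimately have "closed (- D)" by (simp only:)
  then show ?thesis by (simp only: open_closed)
qed

text \<open>Clusters are named by points of the manifold; the type argument is the dimension of the cells.\<close>

definition cell_product ::
    "'m::finite itself \<Rightarrow> ('a::topological_space ^ 'n::finite) set \<Rightarrow> bool" where
  "cell_product TYPE('m) W \<longleftrightarrow>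
     (\<exists>(r :: 'n \<Rightarrow> 'a) (K :: 'a \<Rightarrow> (real ^ 'm) set) B \<theta> \<kappa>. convex_cells r K B \<theta> \<kappa> \<and> (\<forall>j. open (B (r j))) \<and>
       W = {x. \<forall>j. x $ j \<in> B (r j)})"

lemma separated_finite:
  fixes V :: "'a::t2_space set"
  assumes "finite V"
  obtains N where "\<And>v. open (N v)" "\<And>v. v \<in> N v"
    "\<And>v w. v \<in> V \<Longrightarrow> w \<in> V \<Longrightarrow> v \<noteq> w \<Longrightarrow> N v \<inter> N w = {}"
proof -
  have "\<forall>v w :: 'a. \<exists>P Q. v \<noteq> w \<longrightarrow> open P \<and> open Q \<and> v \<in> P \<and> w \<in> Q \<and> P \<inter> Q = {}"
    using hausdorff by metis
  then obtain P Q where PQ: "\<And>v w :: 'a. v \<noteq> w \<Longrightarrow>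
      open (P v w) \<and> open (Q v w) \<and> v \<in> P v w \<and> w \<in> Q v w \<and> P v w \<inter> Q v w = {}"
    by metis
  \<comment> \<open>The pairs chosen for \<open>(v, w)\<close> and for \<open>(w, v)\<close> are
    unrelated, so each point takes its neighbourhoods from both.\<close>
  define N where "N v = (\<Inter>w\<in>V - {v}. P v w \<inter> Q w v)" for v
  show ?thesis
  proof
    show "open (N v)" for v
      unfolding N_def using assms PQ by (intro open_INT ballI open_Int) auto
    show "v \<in> N v" for v
    proof -
      have "v \<in> P v w \<inter> Q w v" if "w \<in> V - {v}" for w
        using PQ[of v w] PQ[of w v] that by auto
      then show ?thesis unfolding N_def by (rule INT_I)
    qed
    show "N v \<inter> N w = {}" if "v \<in> V" "w \<in> V" "v \<noteq> w" for v w
    proof -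
      have "N v \<subseteq> P v w" "N w \<subseteq> Q v w" unfolding N_def using that by auto
      then show ?thesis using PQ[OF that(3)] by auto
    qed
  qed
qed

text \<open>The clusters are read off from \<open>X\<close> itself by taking \<open>r\<close> to be
  \<open>($) X\<close>: coinciding entries share a cell, and distinct entries get disjoint
  ones.\<close>

lemma cell_product_basis:
  fixes A :: "('a::t2_space, 'm::finite) chart set"
  assumes A: "oriented_smooth_atlas A" and dim: "2 \<le> CARD('m)"
    and U: "open U" "(X :: 'a ^ 'n::finite) \<in> U"
  shows "\<exists>W. cell_product TYPE('m) W \<and> X \<in> W \<and> W \<subseteq> U"
proof -
  obtain T where T: "\<And>j. open (T j)" "\<And>j. X $ j \<in> T j" "\<And>y. (\<forall>j. y $ j \<in> T j) \<Longrightarrow> y \<in> U"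
    using U unfolding open_vec_def by metis
  have fin: "finite (range (($) X))" by simp
  obtain N where N: "\<And>v. open (N v)" "\<And>v. v \<in> N v"
    "\<And>v w. v \<in> range (($) X) \<Longrightarrow> w \<in> range (($) X) \<Longrightarrow> v \<noteq> w \<Longrightarrow> N v \<inter> N w = {}"
    by (rule separated_finite[OF fin], rule that)
  define O' where "O' v = N v \<inter> (\<Inter>j\<in>{j. X $ j = v}. T j)" for v
  have O': "open (O' v)" "v \<in> O' v" for v
    unfolding O'_def using N T by (auto intro!: open_Int open_INT)
  \<comment> \<open>The four data of a cell are packed into one nested pair, so that a single choice
    for each \<open>v\<close> produces them together.\<close>
  define P where "P v c \<longleftrightarrow> open (fst (snd c)) \<and> v \<in> fst (snd c) \<and> fst (snd c) \<subseteq> O' v \<and>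
      homeomorphism (fst c :: (real ^ 'm) set) (fst (snd c)) (fst (snd (snd c))) (snd (snd (snd c))) \<and>
      convex (fst c) \<and> bounded (fst c) \<and> interior (fst c) \<noteq> {}" for v c
  have "\<exists>c. P v c" for v
  proof -
    obtain U \<psi> K where "(U, \<psi>) \<in> A" "K \<subseteq> \<psi> ` U" "open {y \<in> U. \<psi> y \<in> K}" "v \<in> U" "\<psi> v \<in> K" "{y \<in> U. \<psi> y \<in> K} \<subseteq> O' v"
      "homeomorphism K {y \<in> U. \<psi> y \<in> K} (inv_into U \<psi>) \<psi>" "convex K" "bounded K" "interior K \<noteq> {}"
      by (rule chart_cell[OF A O'(1)[of v] O'(2)[of v]])
    then show ?thesis
      by (intro exI[of _ "(K, {y \<in> U. \<psi> y \<in> K}, inv_into U \<psi>, \<psi>)"]) (simp add: P_def)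
  qed
  then obtain c where c: "P v (c v)" for v
    by metis
  define K B \<theta> \<kappa> where "K v = fst (c v)" and "B v = fst (snd (c v))" and "\<theta> v = fst (snd (snd (c v)))"
    and "\<kappa> v = snd (snd (snd (c v)))" for v
  have KB: "open (B v)" "v \<in> B v" "B v \<subseteq> O' v" "homeomorphism (K v) (B v) (\<theta> v) (\<kappa> v)"
    "convex (K v)" "bounded (K v)" "interior (K v) \<noteq> {}" for v
    using c[of v] by (simp_all add: P_def K_def B_def \<theta>_def \<kappa>_def)
  have "convex_cells (($) X) K B \<theta> \<kappa>"
  proof
    show "2 \<le> DIM(real ^ 'm)" using dim by simp
    show "B (X $ i) \<inter> B (X $ j) = {}" if "X $ i \<noteq> X $ j" for i j
      using N(3)[OF _ _ that] KB(3)[of "X $ i"] KB(3)[of "X $ j"] by (auto simp: O'_def)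
  qed (use KB in auto)
  then have "cell_product TYPE('m) {x. \<forall>j. x $ j \<in> B (X $ j)}"
    unfolding cell_product_def using KB(1) by blast
  moreover have "X \<in> {x. \<forall>j. x $ j \<in> B (X $ j)}" using KB(2) by simp
  moreover have "{x. \<forall>j. x $ j \<in> B (X $ j)} \<subseteq> U"
  proof
    fix y assume "y \<in> {x. \<forall>j. x $ j \<in> B (X $ j)}"
    then have "y $ j \<in> T j" for j using KB(3)[of "X $ j"] by (auto simp: O'_def)
    then show "y \<in> U" using T(3) by blast
  qed
  ultimately show ?thesis by blast
qed

text \<open>The top cell is the degenerate instance with all points in one cluster;
  \<open>confs\<close> then becomes the configuration space of \<open>D\<close>.\<close>

lemma convex_cells_open_ball:
  assumes "homeomorphism (ball (0 :: real ^ 'm::finite) 1) D \<theta> \<kappa>" "2 \<le> CARD('m)"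
  shows "convex_cells (\<lambda>_ :: 'n::finite. ()) (\<lambda>_. ball (0 :: real ^ 'm) 1) (\<lambda>_. D) (\<lambda>_. \<theta>) (\<lambda>_. \<kappa>)"
  by unfold_locales (use assms in \<open>auto simp: interior_open\<close>)

section \<open>Isotopies and the group of homeomorphisms\<close>

text \<open>Continuity is asked on the whole ambient type, where compactness is available, while
  \<open>S\<close> is the part that has to be preserved.\<close>

definition flow_on :: "'b::topological_space set \<Rightarrow> (real \<times> 'b \<Rightarrow> 'b) \<Rightarrow> bool" where
  "flow_on S E \<longleftrightarrow>
     continuous_on ({0..1} \<times> UNIV) E \<and> E ` ({0..1} \<times> S) \<subseteq> S \<and> (\<forall>x. E (0, x) = x)"

lemma flow_on_in: "flow_on S E \<Longrightarrow> t \<in> {0..1} \<Longrightarrow> x \<in> S \<Longrightarrow> E (t, x) \<in> S"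
  unfolding flow_on_def by (meson SigmaI image_subset_iff)

lemma flow_on_square:
  assumes E: "flow_on S E" and p: "path p" "path_image p \<subseteq> S"
  shows "continuous_on ({0..1} \<times> {0..1}) (\<lambda>(t, s). E (t, p s))"
    and "(\<lambda>(t, s). E (t, p s)) ` ({0..1} \<times> {0..1}) \<subseteq> S"
    and "continuous_on ({0..1} \<times> {0..1}) (\<lambda>(t, s). E (s, p t))"
    and "(\<lambda>(t, s). E (s, p t)) ` ({0..1} \<times> {0..1}) \<subseteq> S"
proof -
  have c: "continuous_on ({0..1} \<times> UNIV) E" using E by (simp add: flow_on_def)
  have p': "continuous_on {0..1} p" using p(1) by (simp add: path_def)
  have ps: "p s \<in> S" if "s \<in> {0..1}" for s using p(2) that by (auto simp: path_image_def)
  show "continuous_on ({0..1} \<times> {0..1}) (\<lambda>(t, s). E (t, p s))"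
    "continuous_on ({0..1} \<times> {0..1}) (\<lambda>(t, s). E (s, p t))"
    unfolding case_prod_unfold
    by (rule continuous_on_compose2[OF c],
        intro continuous_intros continuous_on_compose2[OF p'], auto)+
  show "(\<lambda>(t, s). E (t, p s)) ` ({0..1} \<times> {0..1}) \<subseteq> S"
    "(\<lambda>(t, s). E (s, p t)) ` ({0..1} \<times> {0..1}) \<subseteq> S"
    using flow_on_in[OF E _ ps] by auto
qed

lemma flow_on_path:
  assumes "flow_on S E" "x \<in> S"
  shows "path (\<lambda>t. E (t, x))" "path_image (\<lambda>t. E (t, x)) \<subseteq> S"
    "pathstart (\<lambda>t. E (t, x)) = x" "pathfinish (\<lambda>t. E (t, x)) = E (1, x)"
proof -
  have "continuous_on {0..1} (\<lambda>t. E (t, x))"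
    by (rule continuous_on_compose2[of "{0..1} \<times> UNIV" E])
      (use assms in \<open>auto simp: flow_on_def intro!: continuous_intros\<close>)
  then show "path (\<lambda>t. E (t, x))" "path_image (\<lambda>t. E (t, x)) \<subseteq> S"
    "pathstart (\<lambda>t. E (t, x)) = x" "pathfinish (\<lambda>t. E (t, x)) = E (1, x)"
    using assms(1) flow_on_in[OF assms(1) _ assms(2)]
    by (auto simp: flow_on_def path_def path_image_def pathstart_def pathfinish_def)
qed

text \<open>In the square spanned by the parameter of \<open>p\<close> and the time of the flow, the
  diagonal is homotopic to two consecutive sides. With the trace of another flow as
  \<open>p\<close>, the trace of a composition becomes a concatenation.\<close>

lemma homotopic_paths_flow:
  assumes E: "flow_on S E" and p: "path p" "path_image p \<subseteq> S"
  shows "homotopic_paths S (\<lambda>t. E (t, p t)) (p +++ (\<lambda>t. E (t, pathfinish p)))"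
proof -
  let ?Q = "\<lambda>(t, s). E (s, p t)"
  let ?T = "{0..1} \<times> {0..1} :: (real \<times> real) set"
  let ?a = "linepath (0, 0) (1, 1) :: real \<Rightarrow> real \<times> real"
  let ?b1 = "linepath (0, 0) (1, 0) :: real \<Rightarrow> real \<times> real"
  let ?b2 = "linepath (1, 0) (1, 1) :: real \<Rightarrow> real \<times> real"
  have T: "convex ?T" by (intro convex_Times) auto
  have seg: "path_image (linepath x y) \<subseteq> ?T" if "x \<in> ?T" "y \<in> ?T" for x y
    unfolding path_image_linepath using closed_segment_subset[OF that T] .
  have "homotopic_paths S (?Q \<circ> ?a) (?Q \<circ> (?b1 +++ ?b2))"
  proof (rule homotopic_paths_compose_convex[OF T flow_on_square(3,4)[OF E p]])
    show "path_image ?a \<subseteq> ?T" by (intro seg) auto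
    show "path_image (?b1 +++ ?b2) \<subseteq> ?T" by (intro subset_path_image_join seg) auto
  qed auto
  moreover have "?Q \<circ> ?a = (\<lambda>t. E (t, p t))" "?Q \<circ> ?b1 = p" "?Q \<circ> ?b2 = (\<lambda>t. E (t, pathfinish p))"
    using E by (auto simp: linepath_def fun_eq_iff flow_on_def pathfinish_def)
  ultimately show ?thesis
    by (simp add: path_compose_join)
qed

section \<open>Traces of flows in the target group\<close>

context path_functor
begin

lemma F_flow_compose:
  assumes "flow_on S E" "flow_on S E'" "x \<in> S"
  shows "F (\<lambda>t. E (t, E' (t, x))) = F (\<lambda>t. E' (t, x)) \<otimes> F (\<lambda>t. E (t, E' (1, x)))"
proof -
  note p = flow_on_path[OF assms(2,3)]
  have y: "E' (1, x) \<in> S" using flow_on_in[OF assms(2) _ assms(3), of 1] by simp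
  have "F (\<lambda>t. E (t, E' (t, x))) = F ((\<lambda>t. E' (t, x)) +++ (\<lambda>t. E (t, E' (1, x))))"
    using F_homotopic[OF homotopic_paths_flow[OF assms(1) p(1,2)]] p(4) by simp
  then show ?thesis
    using F_join p flow_on_path[OF assms(1) y] by simp
qed

text \<open>Both flows carry a loop \<open>\<beta>\<close> at \<open>z\<close> to the same loop, conjugating \<open>\<beta>\<close> along their traces.\<close>

lemma flow_traces_differ_by_central:
  assumes E: "flow_on S E" and E': "flow_on S E'" and eq: "\<And>x. E (1, x) = E' (1, x)"
    and z: "z \<in> S" "E (1, z) = z" and \<beta>: "\<beta> \<in> loops_at S z"
  shows "(F (\<lambda>t. E (t, z)) \<otimes> inv (F (\<lambda>t. E' (t, z)))) \<otimes> F \<beta> =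
    F \<beta> \<otimes> (F (\<lambda>t. E (t, z)) \<otimes> inv (F (\<lambda>t. E' (t, z))))"
proof -
  have b: "path \<beta>" "path_image \<beta> \<subseteq> S" "pathstart \<beta> = z" "pathfinish \<beta> = z"
    using \<beta> by (auto simp: loops_at_def)
  have *: "F \<beta> = F (\<lambda>t. E (t, z)) \<otimes> (F (\<lambda>s. E' (1, \<beta> s)) \<otimes> inv (F (\<lambda>t. E (t, z))))"
    "F (\<lambda>s. E' (1, \<beta> s)) \<in> carrier G" "F (\<lambda>t. E (t, z)) \<in> carrier G"
    if E: "flow_on S E" and eq: "\<And>x. E (1, x) = E' (1, x)" and z': "E (1, z) = z" for E
  proof -
    note sq = flow_on_square(1,2)[OF E b(1,2)]
    note pt = flow_on_path[OF E z(1)]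
    have p1: "path (\<lambda>s. E (1, \<beta> s))" "path_image (\<lambda>s. E (1, \<beta> s)) \<subseteq> S"
      using path_of_continuous_square(1,2)[OF sq, of 1] by auto
    have p1': "pathstart (\<lambda>s. E (1, \<beta> s)) = z" "pathfinish (\<lambda>s. E (1, \<beta> s)) = z"
      using b(3,4) z' by (auto simp: pathstart_def pathfinish_def)
    have b01: "\<beta> 0 = z" "\<beta> 1 = z" using b by (auto simp: pathstart_def pathfinish_def)
    have E0: "E (0, x) = x" for x using E by (simp add: flow_on_def)
    have "homotopic_paths S \<beta> ((\<lambda>t. E (t, z)) +++ (\<lambda>s. E (1, \<beta> s)) +++ reversepath (\<lambda>t. E (t, z)))"
      using homotopic_paths_square[OF sq] by (simp add: b01 E0)
    then have "F \<beta> = F ((\<lambda>t. E (t, z)) +++ (\<lambda>s. E (1, \<beta> s)) +++ reversepath (\<lambda>t. E (t, z)))"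
      by (rule F_homotopic)
    also have "\<dots> = F (\<lambda>t. E (t, z)) \<otimes> (F (\<lambda>s. E (1, \<beta> s)) \<otimes> inv (F (\<lambda>t. E (t, z))))"
      using pt p1 p1' z' by (simp add: F_join F_reverse subset_path_image_join)
    finally show "F \<beta> = F (\<lambda>t. E (t, z)) \<otimes> (F (\<lambda>s. E' (1, \<beta> s)) \<otimes> inv (F (\<lambda>t. E (t, z))))"
      by (simp add: eq)
    show "F (\<lambda>s. E' (1, \<beta> s)) \<in> carrier G" "F (\<lambda>t. E (t, z)) \<in> carrier G"
      using F_closed[OF p1] F_closed[OF pt(1,2)] by (simp_all add: eq)
  qed
  define a b c where "a = F (\<lambda>t. E (t, z))" and "b = F (\<lambda>t. E' (t, z))" and "c = F (\<lambda>s. E' (1, \<beta> s))"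
  have cl: "a \<in> carrier G" "b \<in> carrier G" "c \<in> carrier G"
    using *(2,3)[OF E eq z(2)] *(3)[OF E' refl] eq z(2) by (auto simp: a_def b_def c_def)
  have 1: "F \<beta> = a \<otimes> (c \<otimes> inv a)"
    using *(1)[OF E eq z(2)] by (simp add: a_def c_def)
  have 2: "F \<beta> = b \<otimes> (c \<otimes> inv b)"
    using *(1)[OF E' refl] eq z(2) by (simp add: b_def c_def)
  have "(a \<otimes> inv b) \<otimes> F \<beta> = a \<otimes> (c \<otimes> inv b)"
    unfolding 2 using cl by (simp add: m_assoc inv_mult_cancel)
  also have "\<dots> = F \<beta> \<otimes> (a \<otimes> inv b)"
    unfolding 1 using cl by (simp add: m_assoc inv_mult_cancel)
  finally show ?thesis by (simp add: a_def b_def)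
qed

end

section \<open>Isotopies acting on configurations\<close>

definition conf_flow :: "(real \<Rightarrow> 'a \<Rightarrow> 'a) \<Rightarrow> real \<times> ('a ^ 'n::finite) \<Rightarrow> 'a ^ 'n" where
  "conf_flow H = (\<lambda>(t, x). \<chi> i. H t (x $ i))"

lemma flow_on_conf_flow:
  assumes "isotopy_from_id A H f"
  shows "flow_on (conf UNIV :: ('a::topological_space ^ 'n::finite) set) (conf_flow H)"
  unfolding flow_on_def
proof (intro conjI allI)
  have c: "continuous_on ({0..1} \<times> UNIV) (\<lambda>(t, x). H t x)" and H0: "H 0 = id"
    and hom: "\<And>t. t \<in> {0..1} \<Longrightarrow> H t \<in> Homeo_rel_boundary A"
    using assms by (auto simp: isotopy_from_id_def)
  show "continuous_on ({0..1} \<times> UNIV) (conf_flow H :: real \<times> ('a ^ 'n) \<Rightarrow> 'a ^ 'n)"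
    unfolding conf_flow_def case_prod_unfold
  proof (rule continuous_on_vec_lambda)
    fix i :: 'n
    have "continuous_on ({0..1} \<times> UNIV) (\<lambda>x :: real \<times> ('a ^ 'n). (\<lambda>(t, x). H t x) (fst x, snd x $ i))"
      by (rule continuous_on_compose2[OF c]) (auto intro!: continuous_intros continuous_on_component)
    then show "continuous_on ({0..1} \<times> UNIV) (\<lambda>x :: real \<times> ('a ^ 'n). H (fst x) (snd x $ i))" by simp
  qed
  have "inj (H t)" if "t \<in> {0..1}" for t
    using hom[OF that] unfolding Homeo_rel_boundary_def homeomorphism_def by (auto intro: inj_on_inverseI)
  then have "H t x \<noteq> H t y" if "t \<in> {0..1}" "x \<noteq> y" for t x y
    using that by (simp add: inj_eq)
  then show "conf_flow H ` ({0..1} \<times> (conf UNIV :: ('a ^ 'n) set)) \<subseteq> conf UNIV"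
    by (auto simp: conf_flow_def mem_conf)
  show "conf_flow H (0, x) = x" for x :: "'a ^ 'n"
    by (simp add: conf_flow_def H0 vec_eq_iff)
qed

lemma conf_flow_comp: "conf_flow (\<lambda>t. J t \<circ> J' t) (t, x) = conf_flow J (t, conf_flow J' (t, x))"
  by (simp add: conf_flow_def)

lemma conf_flow_1: "isotopy_from_id A H f \<Longrightarrow> conf_flow H (1, x) = (\<chi> i. f (x $ i))"
  by (simp add: conf_flow_def isotopy_from_id_def)

lemma Homeo_rel_boundary_comp:
  assumes "f \<in> Homeo_rel_boundary A" "g \<in> Homeo_rel_boundary A"
  shows "f \<circ> g \<in> Homeo_rel_boundary A"
proof -
  obtain f' g' M N where "homeomorphism UNIV UNIV f f'" "homeomorphism UNIV UNIV g g'"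
    and M: "open M" "mfd_boundary A \<subseteq> M" "\<forall>x\<in>M. f x = x"
    and N: "open N" "mfd_boundary A \<subseteq> N" "\<forall>x\<in>N. g x = x"
    using assms unfolding Homeo_rel_boundary_def by blast
  then have "homeomorphism UNIV UNIV (f \<circ> g) (g' \<circ> f')"
    using homeomorphism_compose by blast
  moreover have "open (M \<inter> N)" "mfd_boundary A \<subseteq> M \<inter> N" "\<forall>x\<in>M \<inter> N. (f \<circ> g) x = x"
    using M N by auto
  ultimately show ?thesis
    unfolding Homeo_rel_boundary_def by blast
qed

text \<open>Composition is taken stage by stage rather than by running one isotopy after the other,
  so time need not be rescaled; \<open>homotopic_paths_flow\<close> recovers the concatenation up to
  homotopy.\<close>

lemma isotopy_comp:
  assumes J: "isotopy_from_id A J f" and J': "isotopy_from_id A J' g"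
  shows "isotopy_from_id A (\<lambda>t. J t \<circ> J' t) (f \<circ> g)"
proof -
  have c: "continuous_on ({0..1} \<times> UNIV) (\<lambda>(t, x). J t x)" "continuous_on ({0..1} \<times> UNIV) (\<lambda>(t, x). J' t x)"
    using assms by (auto simp: isotopy_from_id_def)
  have "continuous_on ({0..1} \<times> UNIV) (\<lambda>x. (\<lambda>(t, x). J t x) (fst x, (\<lambda>(t, x). J' t x) x))"
    by (rule continuous_on_compose2[OF c(1)]) (use c(2) in \<open>auto intro!: continuous_intros\<close>)
  then have "continuous_on ({0..1} \<times> UNIV) (\<lambda>(t, x). (J t \<circ> J' t) x)"
    by (simp add: case_prod_unfold)
  then show ?thesis
    using assms by (auto simp: isotopy_from_id_def intro!: Homeo_rel_boundary_comp)
qed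

lemma isotopy_id: "isotopy_from_id A (\<lambda>_. id) id"
proof -
  have "(id :: 'a \<Rightarrow> 'a) \<in> Homeo_rel_boundary A"
    unfolding Homeo_rel_boundary_def
    by (auto intro!: exI[of _ id] exI[of _ UNIV] simp: homeomorphism_def)
  moreover have "continuous_on ({0..1} \<times> UNIV) (\<lambda>(t :: real, x :: 'a). id x)"
    unfolding case_prod_unfold id_def by (intro continuous_intros)
  ultimately show ?thesis by (simp add: isotopy_from_id_def)
qed

lemma Homeo0_iff: "f \<in> Homeo0 A \<longleftrightarrow> (\<exists>H. isotopy_from_id A H f)"
proof -
  have "f \<in> Homeo_rel_boundary A" if "isotopy_from_id A H f" for H
  proof -
    have "H 1 \<in> Homeo_rel_boundary A" "H 1 = f"
      using that by (auto simp: isotopy_from_id_def)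
    then show ?thesis by simp
  qed
  then show ?thesis by (auto simp: Homeo0_def)
qed

text \<open>Running \<open>H\<close> backwards after the fixed map \<open>g\<close> gives an isotopy
  to \<open>g\<close>. This avoids inverting every stage, which would require joint continuity of
  the inverses.\<close>

lemma Homeo0_inverse:
  assumes "f \<in> Homeo0 A"
  obtains g where "g \<in> Homeo0 A" "g \<circ> f = id"
proof -
  obtain H where H: "isotopy_from_id A H f" and f: "f \<in> Homeo_rel_boundary A"
    using assms by (auto simp: Homeo0_def)
  obtain g N where g: "homeomorphism UNIV UNIV f g" and N: "open N" "mfd_boundary A \<subseteq> N" "\<forall>x\<in>N. f x = x"
    using f unfolding Homeo_rel_boundary_def by blast
  have gf: "g (f x) = x" "f (g x) = x" for x using g by (auto simp: homeomorphism_def)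
  have cg: "continuous_on UNIV g" using g by (simp add: homeomorphism_def)
  have "g x = x" if "x \<in> N" for x using gf(1)[of x] N(3) that by simp
  then have gH: "g \<in> Homeo_rel_boundary A"
    unfolding Homeo_rel_boundary_def using N homeomorphism_symD[OF g] by blast
  have c: "continuous_on ({0..1} \<times> UNIV) (\<lambda>(t, x). H t x)"
    using H by (auto simp: isotopy_from_id_def)
  have "continuous_on ({0..1} \<times> UNIV) (\<lambda>x. (\<lambda>(t, x). H t x) (1 - fst x, g (snd x)))"
    by (rule continuous_on_compose2[OF c])
      (auto intro!: continuous_intros continuous_on_compose2[OF cg])
  then have "continuous_on ({0..1} \<times> UNIV) (\<lambda>(t, x). (H (1 - t) \<circ> g) x)"
    by (simp add: case_prod_unfold)
  moreover have "H (1 - t) \<circ> g \<in> Homeo_rel_boundary A" if "t \<in> {0..1}" for t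
    using H that by (intro Homeo_rel_boundary_comp gH) (auto simp: isotopy_from_id_def)
  moreover have "H (1 - 0) \<circ> g = id" "H (1 - 1) \<circ> g = g"
    using H gf by (auto simp: isotopy_from_id_def fun_eq_iff)
  ultimately have "isotopy_from_id A (\<lambda>t. H (1 - t) \<circ> g) g"
    by (auto simp: isotopy_from_id_def)
  then have "g \<in> Homeo0 A" unfolding Homeo0_iff by blast
  moreover have "g \<circ> f = id" using gf by (auto simp: fun_eq_iff)
  ultimately show ?thesis using that by blast
qed

lemma group_Homeo0: "group (Homeo0_group A)"
proof (rule groupI)
  show "x \<otimes>\<^bsub>Homeo0_group A\<^esub> y \<in> carrier (Homeo0_group A)"
    if xy: "x \<in> carrier (Homeo0_group A)" "y \<in> carrier (Homeo0_group A)" for x y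
  proof -
    obtain J J' where "isotopy_from_id A J x" "isotopy_from_id A J' y"
      using xy[unfolded Homeo0_group_def] by (auto simp: Homeo0_iff)
    then have "isotopy_from_id A (\<lambda>t. J t \<circ> J' t) (x \<circ> y)" by (rule isotopy_comp)
    then show ?thesis by (auto simp: Homeo0_group_def Homeo0_iff)
  qed
  have "id \<in> Homeo0 A"
    using isotopy_id unfolding Homeo0_iff by blast
  then show "\<one>\<^bsub>Homeo0_group A\<^esub> \<in> carrier (Homeo0_group A)"
    by (simp add: Homeo0_group_def)
  show "\<exists>y\<in>carrier (Homeo0_group A). y \<otimes>\<^bsub>Homeo0_group A\<^esub> x = \<one>\<^bsub>Homeo0_group A\<^esub>"
    if "x \<in> carrier (Homeo0_group A)" for x
  proof -
    have "x \<in> Homeo0 A" using that by (simp add: Homeo0_group_def)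
    then obtain g where "g \<in> Homeo0 A" "g \<circ> x = id" by (rule Homeo0_inverse)
    then show ?thesis by (auto simp: Homeo0_group_def)
  qed
qed (auto simp: Homeo0_group_def comp_assoc)

section \<open>Local braids and the theorem\<close>

lemma loops_at_conf_mono: "p \<in> loops_at (conf X) z \<Longrightarrow> p \<in> loops_at (conf UNIV) z"
  by (auto simp: loops_at_def mem_conf subset_iff)

text \<open>Density gives every open cell a point of \<open>D\<close>, so the clusterwise
  contraction applies with \<open>D\<close> as its target.\<close>

lemma loop_in_cell_product_homotopic:
  fixes p :: "real \<Rightarrow> 'a::topological_space ^ 'n::finite"
  assumes W: "cell_product TYPE('m::finite) W"
    and D: "open D" "\<And>O'. open O' \<Longrightarrow> O' \<noteq> {} \<Longrightarrow> O' \<inter> D \<noteq> {}"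
    and p: "path p" "path_image p \<subseteq> W \<inter> conf UNIV" "pathfinish p = pathstart p"
  obtains q p' where "path q" "path_image q \<subseteq> conf UNIV" "path p'" "path_image p' \<subseteq> conf D"
    "pathstart q = pathstart p" "pathfinish q = pathstart p'" "pathfinish p' = pathstart p'"
    "homotopic_paths (conf UNIV) p (q +++ p' +++ reversepath q)"
proof -
  obtain r :: "'n \<Rightarrow> 'a" and K :: "'a \<Rightarrow> (real ^ 'm) set" and B \<theta> \<kappa>
    where cells: "convex_cells r K B \<theta> \<kappa>" and op: "\<And>j. open (B (r j))" and Weq: "W = {x. \<forall>j. x $ j \<in> B (r j)}"
    using W unfolding cell_product_def by blast
  interpret convex_cells r K B \<theta> \<kappa> by fact
  have W': "W \<inter> conf UNIV = confs" by (simp add: Weq confs_def)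
  have ne: "B (r j) \<noteq> {}" for j
    using interior[of j] interior_subset[of "K (r j)"] \<theta>_in[of _ j] by blast
  obtain q p' where *: "path q" "path_image q \<subseteq> confs" "path p'" "path_image p' \<subseteq> confs \<inter> conf D"
    "pathfinish q = pathstart p'" "pathfinish p' = pathstart p'"
    "homotopic_paths confs p (q +++ p' +++ reversepath q)"
    by (rule loop_homotopic_into[OF D(1) D(2)[OF op ne] p(1) p(2)[unfolded W'] p(3)])
  have sub: "confs \<subseteq> conf UNIV" by (auto simp: confs_def)
  have "pathstart q = pathstart p"
    using homotopic_paths_imp_pathstart[OF *(7)] by simp
  moreover have "homotopic_paths (conf UNIV) p (q +++ p' +++ reversepath q)"
    by (rule homotopic_paths_subset[OF *(7) sub])
  ultimately show ?thesis
    using * sub by (intro that[of q p']) auto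
qed

text \<open>The conjugating path that the contraction produces for the constant loop at
  \<open>x\<close> already leads from \<open>x\<close> to a configuration in \<open>D\<close>, and
  there \<open>conn\<close> applies.\<close>

lemma path_connected_conf_UNIV:
  fixes A :: "('a::t2_space, 'm::finite) chart set"
  assumes A: "oriented_smooth_atlas A" and dim: "2 \<le> CARD('m)"
    and D: "open D" "\<And>O'. open O' \<Longrightarrow> O' \<noteq> {} \<Longrightarrow> O' \<inter> D \<noteq> {}"
    and conn: "path_connected (conf D :: ('a ^ 'n::finite) set)"
  shows "path_connected (conf UNIV :: ('a ^ 'n) set)"
proof -
  have *: "\<exists>q. path q \<and> path_image q \<subseteq> conf UNIV \<and> pathstart q = x \<and> pathfinish q \<in> conf D"
    if x: "x \<in> conf UNIV" for x :: "'a ^ 'n"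
  proof -
    obtain W where W: "cell_product TYPE('m) W" "x \<in> W"
      using cell_product_basis[OF A dim open_UNIV, of x] by blast
    obtain q p' where q: "path q" "path_image q \<subseteq> conf UNIV" "path p'" "path_image p' \<subseteq> conf D"
      "pathstart q = pathstart (\<lambda>_. x)" "pathfinish q = pathstart p'" "pathfinish p' = pathstart p'"
      "homotopic_paths (conf UNIV) (\<lambda>_. x) (q +++ p' +++ reversepath q)"
      by (rule loop_in_cell_product_homotopic[OF W(1) D, of "\<lambda>_. x"]) (use W x in auto)
    have "pathfinish q \<in> conf D"
      using q(4,6) pathstart_in_path_image[of p'] by auto
    then show ?thesis using q by (intro exI[of _ q]) simp
  qed
  have sub: "conf D \<subseteq> (conf UNIV :: ('a ^ 'n) set)" by (auto simp: mem_conf)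
  show ?thesis
    unfolding path_connected_def
  proof (intro ballI)
    fix x y :: "'a ^ 'n" assume xy: "x \<in> conf UNIV" "y \<in> conf UNIV"
    obtain p where p: "path p" "path_image p \<subseteq> conf UNIV" "pathstart p = x" "pathfinish p \<in> conf D"
      using *[OF xy(1)] by blast
    obtain q where q: "path q" "path_image q \<subseteq> conf UNIV" "pathstart q = y" "pathfinish q \<in> conf D"
      using *[OF xy(2)] by blast
    obtain d where d: "path d" "path_image d \<subseteq> conf D" "pathstart d = pathfinish p" "pathfinish d = pathfinish q"
      using conn p(4) q(4) unfolding path_connected_def by blast
    have "path (p +++ d +++ reversepath q)" using p q d by simp
    moreover have "path_image (p +++ d +++ reversepath q) \<subseteq> conf UNIV"
      using p q d sub by (intro subset_path_image_join) auto
    ultimately show "\<exists>g. path g \<and> path_image g \<subseteq> conf UNIV \<and> pathstart g = x \<and> pathfinish g = y"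
      using p q by (intro exI[of _ "p +++ d +++ reversepath q"]) simp
  qed
qed

section \<open>Traces of words and of powers\<close>

lemma (in quasimorphism_functor) twisted_flow_compose:
  assumes E: "flow_on S E" "flow_on S E'" and x: "x \<in> S" and \<tau>: "\<tau> \<in> S \<rightarrow> carrier G"
  shows "\<bar>twisted \<tau> (\<lambda>t. E (t, E' (t, x)))\<bar> \<le>
    \<bar>twisted \<tau> (\<lambda>t. E' (t, x))\<bar> + \<bar>twisted \<tau> (\<lambda>t. E (t, E' (1, x)))\<bar> + D"
proof -
  note p = flow_on_path[OF E(2) x]
  have y: "E' (1, x) \<in> S" using flow_on_in[OF E(2) _ x, of 1] by simp
  have "twisted \<tau> (\<lambda>t. E (t, E' (t, x))) = twisted \<tau> ((\<lambda>t. E' (t, x)) +++ (\<lambda>t. E (t, E' (1, x))))"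
    using twisted_homotopic[OF homotopic_paths_flow[OF E(1) p(1,2)]] p(4) by simp
  moreover have "\<bar>twisted \<tau> ((\<lambda>t. E' (t, x)) +++ (\<lambda>t. E (t, E' (1, x)))) -
      twisted \<tau> (\<lambda>t. E' (t, x)) - twisted \<tau> (\<lambda>t. E (t, E' (1, x)))\<bar> \<le> D"
    using p flow_on_path[OF E(1) y] by (intro twisted_join[OF \<tau>]) auto
  ultimately show ?thesis by linarith
qed

text \<open>Each letter costs its own bound \<open>C\<close> and one defect \<open>D\<close>. The
  letters act on configurations already moved by the later part of the word, so the letter bound
  must be uniform in \<open>x\<close>. The composed isotopy \<open>L\<close> need not be related to
  any isotopy given otherwise for the same homeomorphism.\<close>

lemma twisted_word_bound:
  fixes A :: "('a::topological_space, 'm::finite) chart set" and G (structure)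
    and F :: "(real \<Rightarrow> 'a ^ 'n::finite) \<Rightarrow> 'g"
  assumes "quasimorphism_functor G \<phi> D (conf UNIV) F"
    and \<tau>: "\<tau> \<in> conf UNIV \<rightarrow> carrier G" and C: "0 \<le> C"
    and J: "\<And>w. w \<in> T \<Longrightarrow> isotopy_from_id A (J w) w"
    and bound: "\<And>w x. w \<in> T \<Longrightarrow> x \<in> conf UNIV \<Longrightarrow>
      \<bar>quasimorphism_functor.twisted G \<phi> F \<tau> (\<lambda>t. conf_flow (J w) (t, x))\<bar> \<le> C"
    and ws: "set ws \<subseteq> T"
  shows "\<exists>L. isotopy_from_id A L (foldr (\<circ>) ws id) \<and> (\<forall>x\<in>conf UNIV.
    \<bar>quasimorphism_functor.twisted G \<phi> F \<tau> (\<lambda>t. conf_flow L (t, x))\<bar> \<le> real (length ws) * (C + D))"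
  using ws
proof (induction ws)
  interpret quasimorphism_functor G \<phi> D "conf UNIV" F by fact
  case Nil
  have zero: "twisted \<tau> (\<lambda>t. conf_flow (\<lambda>_. id) (t, x)) = 0" if "x \<in> conf UNIV" for x
  proof -
    have "(\<lambda>t. conf_flow (\<lambda>_. id) (t, x)) = (\<lambda>_. x)" by (simp add: conf_flow_def fun_eq_iff vec_eq_iff)
    then show ?thesis
      using F_const[OF that] \<tau> that by (auto simp: twisted_def Pi_iff)
  qed
  show ?case
  proof (intro exI conjI ballI)
    have "foldr (\<circ>) [] id = (id :: 'a \<Rightarrow> 'a)" by (simp add: fun_eq_iff)
    then show "isotopy_from_id A (\<lambda>_. id) (foldr (\<circ>) [] id)"
      using isotopy_id by (simp only:)
    show "\<bar>twisted \<tau> (\<lambda>t. conf_flow (\<lambda>_. id) (t, x))\<bar> \<le> real (length []) * (C + D)"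
      if "x \<in> conf UNIV" for x
      unfolding zero[OF that] by simp
  qed
next
  interpret quasimorphism_functor G \<phi> D "conf UNIV" F by fact
  case (Cons w ws)
  then have "set ws \<subseteq> T" by simp
  then obtain L where L: "isotopy_from_id A L (foldr (\<circ>) ws id)"
    and bd: "\<forall>x\<in>conf UNIV. \<bar>twisted \<tau> (\<lambda>t. conf_flow L (t, x))\<bar> \<le> real (length ws) * (C + D)"
    using Cons.IH by blast
  have w: "w \<in> T" using Cons.prems by simp
  have "\<bar>twisted \<tau> (\<lambda>t. conf_flow (\<lambda>t. J w t \<circ> L t) (t, x))\<bar> \<le> real (length (w # ws)) * (C + D)"
    if x: "x \<in> conf UNIV" for x
  proof -
    note fl = flow_on_conf_flow[OF J[OF w]] flow_on_conf_flow[OF L]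
    have y: "conf_flow L (1, x) \<in> conf UNIV" using flow_on_in[OF fl(2) _ x, of 1] by simp
    show ?thesis
      using twisted_flow_compose[OF fl x \<tau>] bspec[OF bd x] bound[OF w y]
      unfolding conf_flow_comp by (simp add: algebra_simps)
  qed
  moreover have "foldr (\<circ>) (w # ws) id = w \<circ> foldr (\<circ>) ws id" by (simp add: fun_eq_iff)
  ultimately show ?case
    using isotopy_comp[OF J[OF w] L] by (intro exI[of _ "\<lambda>t. J w t \<circ> L t"] conjI ballI) (simp_all only:)
qed

lemma isotopy_funpow:
  assumes H: "isotopy_from_id A H f"
  shows "isotopy_from_id A (\<lambda>t. H t ^^ k) (f ^^ k)"
proof (induction k)
  case 0
  then show ?case using isotopy_id by (simp only: funpow.simps)
next
  case (Suc k)
  then show ?case using isotopy_comp[OF H Suc] by (simp only: funpow.simps)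
qed

text \<open>Every power of \<open>f\<close> fixes \<open>z\<close>, so each further factor
  contributes the same trace, based again at \<open>z\<close>.\<close>

lemma F_trace_funpow:
  fixes F :: "(real \<Rightarrow> 'a::topological_space ^ 'n::finite) \<Rightarrow> 'g" and G (structure)
  assumes "path_functor G (conf UNIV) F" and H: "isotopy_from_id A H f"
    and z: "z \<in> conf UNIV" "\<And>i. f (z $ i) = z $ i"
  shows "F (\<lambda>t. conf_flow (\<lambda>t. H t ^^ k) (t, z)) = F (\<lambda>t. conf_flow H (t, z)) [^] k"
proof (induction k)
  interpret path_functor G "conf UNIV" F by fact
  case 0
  have const: "(\<lambda>t. conf_flow (\<lambda>t. H t ^^ 0) (t, z)) = (\<lambda>_. z)" by (simp add: conf_flow_def fun_eq_iff vec_eq_iff)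
  show ?case unfolding const F_const[OF z(1)] by simp
next
  interpret path_functor G "conf UNIV" F by fact
  case (Suc k)
  note fl = flow_on_conf_flow[OF H] flow_on_conf_flow[OF isotopy_funpow[OF H, of k]]
  have "(f ^^ k) (z $ i) = z $ i" for i by (induction k) (simp_all add: z(2))
  then have end1: "conf_flow (\<lambda>t. H t ^^ k) (1, z) = z"
    using conf_flow_1[OF isotopy_funpow[OF H, of k], of z] by (simp add: vec_eq_iff)
  have step: "(\<lambda>t. conf_flow (\<lambda>t. H t ^^ Suc k) (t, z)) = (\<lambda>t. conf_flow H (t, conf_flow (\<lambda>t. H t ^^ k) (t, z)))"
    by (simp add: conf_flow_def)
  show ?case
    unfolding step F_flow_compose[OF fl z(1)] Suc end1 by simp
qed

theorem corollary1p8: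
  fixes A :: "('a::t2_space, 'm::finite) chart set"
    and \<mu> :: "'a measure"
    and \<Delta> :: "'a set"
    and z :: "'a ^ 'n::finite"
    and \<phi> :: "(real \<Rightarrow> 'a ^ 'n) set \<Rightarrow> real"
    and f :: "'a \<Rightarrow> 'a"
    and H :: "real \<Rightarrow> 'a \<Rightarrow> 'a"
  assumes "CARD('m) \<ge> 2"
    and "CARD('m) \<ge> 3 \<Longrightarrow> CARD('n) = 1"
    and "compact (UNIV :: 'a set)"
    and "connected (UNIV :: 'a set)"
    and "oriented_smooth_atlas A"
    and "prob_space \<mu>"
    and "induced_by_volume_form A \<mu>"
    and "unique_top_cell CARD('m) \<Delta>"
    and "diffeomorphic_to_open_ball A \<Delta>"
    and "measure \<mu> \<Delta> = 1"
    and "z \<in> conf \<Delta>"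
    and "quasimorphism (pure_braid_group z) \<phi>"
    and "homogeneous_on (pure_braid_group z) \<phi>"
    and "\<And>g. g \<in> group_centre (pure_braid_group z) \<Longrightarrow> \<phi> g = 0"
    and "\<And>g. CARD('m) = 2 \<Longrightarrow> g \<in> local_pure_braids \<Delta> z \<Longrightarrow> \<phi> g = 0"
    and "f \<in> Homeo0 A"
    and "\<And>i. f (z $ i) = z $ i"
    and "isotopy_from_id A H f"
    and "\<phi> (isotopy_braid H z) > 0"
  shows "undistorted (Homeo0_group A) f"
proof -
  note dim = assms(1) and comp = assms(3) and atlas = assms(5) and fix_z = assms(17) and H = assms(18)
  let ?S = "conf UNIV :: ('a ^ 'n) set" and ?G = "pure_braid_group z"
  have zS: "z \<in> ?S" using assms(11) by (simp add: mem_conf)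
  have D: "open \<Delta>" using assms(8) by (rule open_unique_top_cell)
  have dense: "O' \<inter> \<Delta> \<noteq> {}" if "open O'" "O' \<noteq> {}" for O'
    using full_measure_imp_dense[OF atlas assms(6,7,10) that] .
  obtain \<theta> \<kappa> where ball: "homeomorphism (ball (0 :: real ^ 'm) 1) \<Delta> \<theta> \<kappa>"
    using assms(9) unfolding diffeomorphic_to_open_ball_def by blast
  interpret D: convex_cells "\<lambda>_ :: 'n. ()" "\<lambda>_. ball (0 :: real ^ 'm) 1" "\<lambda>_. \<Delta>" "\<lambda>_. \<theta>" "\<lambda>_. \<kappa>"
    by (rule convex_cells_open_ball[OF ball dim])
  have confD: "D.confs = conf \<Delta>" by (auto simp: D.confs_def mem_conf)
  have connD: "path_connected (conf \<Delta> :: ('a ^ 'n) set)"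
    using D.path_connected_confs by (simp add: confD)
  have connS: "path_connected ?S"
    by (rule path_connected_conf_UNIV[OF atlas dim D dense connD])
  obtain F where F: "path_functor ?G ?S F" "\<And>p. p \<in> loops_at ?S z \<Longrightarrow> F p = loop_class ?S p"
    using path_functor_loop_class[OF connS zS] unfolding pure_braid_group_def by blast
  interpret path_functor ?G ?S F by (rule F(1))
  obtain Df where Df: "\<And>g h. g \<in> carrier ?G \<Longrightarrow> h \<in> carrier ?G \<Longrightarrow> \<bar>\<phi> h - \<phi> (g \<otimes>\<^bsub>?G\<^esub> h) + \<phi> g\<bar> \<le> Df"
    using assms(12) unfolding quasimorphism_def by blast
  interpret quasimorphism_functor ?G \<phi> Df ?S F
  proof
    show "\<bar>\<phi> (g \<otimes>\<^bsub>?G\<^esub> h) - \<phi> g - \<phi> h\<bar> \<le> Df" if "g \<in> carrier ?G" "h \<in> carrier ?G" for g h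
      using Df[OF that] by linarith
    show "\<phi> (g [^]\<^bsub>?G\<^esub> (k::nat)) = real k * \<phi> g" if "g \<in> carrier ?G" for g k
    proof -
      have "\<phi> (g [^]\<^bsub>?G\<^esub> int k) = of_int (int k) * \<phi> g"
        using assms(13) that unfolding homogeneous_on_def by blast
      then show ?thesis by (simp add: int_pow_int)
    qed
  qed
  \<comment> \<open>For surfaces this is the assumption on local braids; otherwise
    \<open>CARD('n) = 1\<close>, and the loop contracts in the ball.\<close>
  have local_zero: "\<phi> (F p) = 0" if p: "p \<in> loops_at (conf \<Delta>) z" for p
  proof (cases "CARD('m) = 2")
    case True
    then show ?thesis
      using assms(15) F(2)[OF loops_at_conf_mono[OF p]] p by (auto simp: local_pure_braids_def)
  next
    case False
    then have n: "CARD('n) = 1" using assms(1,2) by simp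
    have p': "path p" "path_image p \<subseteq> D.confs" "pathfinish p = pathstart p" "pathstart p = z"
      using p by (auto simp: loops_at_def confD)
    have "D.confs \<subseteq> ?S" by (auto simp: D.confs_def)
    then have "homotopic_paths ?S p (\<lambda>_. z)"
      using homotopic_paths_subset[OF D.loop_null_homotopic_single[OF n p'(1-3)]] p'(4) by simp
    then show ?thesis
      using F_homotopic F_const[OF zS] by simp
  qed
  have loop_zero: "\<phi> (F p) = 0"
    if W: "cell_product TYPE('m) W" and p: "path p" "path_image p \<subseteq> W \<inter> ?S" "pathfinish p = pathstart p" for W p
  proof -
    obtain q p' where q: "path q" "path_image q \<subseteq> ?S" and p': "path p'" "path_image p' \<subseteq> conf \<Delta>"
      "pathstart q = pathstart p" "pathfinish q = pathstart p'" "pathfinish p' = pathstart p'"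
      "homotopic_paths ?S p (q +++ p' +++ reversepath q)"
      by (rule loop_in_cell_product_homotopic[OF W D dense p])
    have sub: "conf \<Delta> \<subseteq> ?S" by (auto simp: mem_conf)
    \<comment> \<open>The contracted loop \<open>p'\<close> is based anywhere in
      \<open>conf \<Delta>\<close>. Moving its base point to \<open>z\<close> inside
      \<open>conf \<Delta>\<close> makes it a local braid, and both this braid and
      \<open>F p\<close> are conjugates of \<open>F p'\<close>.\<close>
    obtain d where d: "path d" "path_image d \<subseteq> conf \<Delta>" "pathstart d = z" "pathfinish d = pathstart p'"
      using connD assms(11) p'(1,2) pathstart_in_path_image[of p'] unfolding path_connected_def by blast
    have "d +++ p' +++ reversepath d \<in> loops_at (conf \<Delta>) z"
      using d p' by (auto simp: loops_at_def subset_path_image_join)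
    then have "\<phi> (F (d +++ p' +++ reversepath d)) = 0" by (rule local_zero)
    moreover have S: "path_image d \<subseteq> ?S" "path_image p' \<subseteq> ?S" using d p' sub by auto
    have "F (d +++ p' +++ reversepath d) = F d \<otimes>\<^bsub>?G\<^esub> (F p' \<otimes>\<^bsub>?G\<^esub> inv\<^bsub>?G\<^esub> F d)"
      using d p' S by (simp add: F_join F_reverse subset_path_image_join)
    moreover have "F p = F q \<otimes>\<^bsub>?G\<^esub> (F p' \<otimes>\<^bsub>?G\<^esub> inv\<^bsub>?G\<^esub> F q)"
      using q p' S F_homotopic[OF p'(6)] by (simp add: F_join F_reverse subset_path_image_join)
    moreover have "F d \<in> carrier ?G" "F p' \<in> carrier ?G" "F q \<in> carrier ?G"
      using F_closed d p' q S by auto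
    ultimately show ?thesis
      using conj_invariant[of "F d" "F p'"] conj_invariant[of "F q" "F p'"] by (simp add: m_assoc)
  qed
  have compS: "compact (UNIV :: ('a ^ 'n) set)" by (rule compact_UNIV_vec[OF comp])
  obtain \<tau> where \<tau>: "\<tau> \<in> ?S \<rightarrow> carrier ?G"
    and \<tau>b: "\<And>X. \<exists>W C. open W \<and> X \<in> W \<and> (\<forall>e. path e \<longrightarrow> path_image e \<subseteq> W \<inter> ?S \<longrightarrow> \<bar>twisted \<tau> e\<bar> \<le> C)"
  proof (rule locally_bounded_twist[OF compS, of "cell_product TYPE('m)"])
    fix W :: "('a ^ 'n) set" assume "cell_product TYPE('m) W"
    then obtain r :: "'n \<Rightarrow> 'a" and K :: "'a \<Rightarrow> (real ^ 'm) set" and B \<theta> \<kappa>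
      where cells: "convex_cells r K B \<theta> \<kappa>" and op: "\<And>j. open (B (r j))" and W: "W = {x. \<forall>j. x $ j \<in> B (r j)}"
      unfolding cell_product_def by blast
    interpret W: convex_cells r K B \<theta> \<kappa> by fact
    have "W \<inter> ?S = W.confs" by (simp add: W W.confs_def)
    then show "path_connected (W \<inter> ?S)" "W \<inter> ?S \<noteq> {}"
      using W.path_connected_confs W.confs_nonempty by simp_all
    show "open W" unfolding W by (rule open_vec_box) (rule op)
  next
    show "\<exists>W. cell_product TYPE('m) W \<and> X \<in> W \<and> W \<subseteq> U" if "open U" "X \<in> U" for U and X :: "'a ^ 'n"
      using cell_product_basis[OF atlas dim that] .
    show "\<exists>V C. open V \<and> closed C \<and> X \<in> V \<and> V \<subseteq> C \<and> C \<subseteq> U" if "open U" "X \<in> U" for U and X :: "'a ^ 'n"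
      using regular_vec[OF comp that] .
  qed (use loop_zero in auto)
  have gen: "\<exists>J C. isotopy_from_id A J w \<and> (\<forall>x\<in>?S. \<bar>twisted \<tau> (\<lambda>t. conf_flow J (t, x))\<bar> \<le> C)"
    if w: "w \<in> Homeo0 A" for w
  proof -
    obtain J where J: "isotopy_from_id A J w" using w by (auto simp: Homeo0_iff)
    have fl: "flow_on ?S (conf_flow J)" by (rule flow_on_conf_flow[OF J])
    obtain C where "\<And>x. x \<in> ?S \<Longrightarrow> \<bar>twisted \<tau> (\<lambda>t. conf_flow J (t, x))\<bar> \<le> C"
      using twisted_flow_bounded[OF compS \<tau> \<tau>b, of "conf_flow J"] fl unfolding flow_on_def by blast
    then show ?thesis using J by blast
  qed
  define a where "a = \<phi> (isotopy_braid H z)"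
  have flH: "flow_on ?S (conf_flow H)" by (rule flow_on_conf_flow[OF H])
  have fz: "(\<chi> i. f (z $ i)) = z" using fix_z by (simp add: vec_eq_iff)
  have "(\<lambda>t. conf_flow H (t, z)) \<in> loops_at ?S z"
    using flow_on_path[OF flH zS] conf_flow_1[OF H, of z] fz by (simp add: loops_at_def)
  then have aF: "a = \<phi> (F (\<lambda>t. conf_flow H (t, z)))"
    by (simp add: F(2) a_def isotopy_braid_def conf_flow_def)
  have clH: "F (\<lambda>t. conf_flow H (t, z)) \<in> carrier ?G"
    using F_closed flow_on_path[OF flH zS] by blast
  \<comment> \<open>\<open>L\<close> is an arbitrary isotopy to the power, later the one read off
    from a word. It is compared with the stagewise power of \<open>H\<close>; splitting off the
    central discrepancy costs one defect.\<close>
  have power_bound: "\<bar>real k * a\<bar> \<le> \<bar>twisted \<tau> (\<lambda>t. conf_flow L (t, z))\<bar> + Df"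
    if L: "isotopy_from_id A L (f ^^ k)" for L k
  proof -
    let ?e = "F (\<lambda>t. conf_flow L (t, z))" and ?h = "F (\<lambda>t. conf_flow (\<lambda>t. H t ^^ k) (t, z))"
    note Hk = isotopy_funpow[OF H, of k]
    note fl = flow_on_conf_flow[OF L, where ?'n = 'n] flow_on_conf_flow[OF Hk, where ?'n = 'n]
    have fk: "(f ^^ k) (z $ i) = z $ i" for i by (induction k) (simp_all add: fix_z)
    have end1: "conf_flow L (1, z) = z"
      using conf_flow_1[OF L, of z] fk by (simp add: vec_eq_iff)
    have same: "conf_flow L (1, x) = conf_flow (\<lambda>t. H t ^^ k) (1, x)" for x :: "'a ^ 'n"
      by (simp add: conf_flow_1[OF L] conf_flow_1[OF Hk])
    have cl: "?e \<in> carrier ?G" "?h \<in> carrier ?G"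
      using F_closed flow_on_path[OF fl(1) zS] flow_on_path[OF fl(2) zS] by auto
    let ?c = "?e \<otimes>\<^bsub>?G\<^esub> inv\<^bsub>?G\<^esub> ?h"
    have "?c \<in> group_centre ?G"
      unfolding group_centre_def
    proof (intro CollectI conjI ballI)
      show "?c \<in> carrier ?G" using cl by simp
      fix g assume "g \<in> carrier ?G"
      then obtain \<beta> where "\<beta> \<in> loops_at ?S z" "g = F \<beta>"
        using F(2) by (auto simp: pure_braid_group_def)
      then show "?c \<otimes>\<^bsub>?G\<^esub> g = g \<otimes>\<^bsub>?G\<^esub> ?c"
        using flow_traces_differ_by_central[OF fl same zS end1] by simp
    qed
    then have "\<phi> ?c = 0" by (rule assms(14))
    moreover have "?c \<otimes>\<^bsub>?G\<^esub> ?h = ?e" using cl by (simp add: m_assoc)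
    ultimately have "\<bar>\<phi> ?e - \<phi> ?h\<bar> \<le> Df"
      using defect[of ?c ?h] cl by simp
    moreover have "\<phi> ?h = real k * a"
      using F_trace_funpow[OF F(1) H zS fix_z] clH by (simp add: nat_pow aF)
    \<comment> \<open>The trace at \<open>z\<close> is closed, so the twist is a conjugation by
      \<open>\<tau> z\<close> and disappears under \<open>\<phi>\<close>.\<close>
    moreover have "twisted \<tau> (\<lambda>t. conf_flow L (t, z)) = \<phi> ?e"
      using flow_on_path(3,4)[OF fl(1) zS] end1 conj_invariant[of "\<tau> z" ?e] \<tau> zS cl
      by (auto simp: twisted_def)
    ultimately show ?thesis by linarith
  qed
  show ?thesis
    unfolding undistorted_def
  proof (intro conjI allI impI)
    show "f \<in> carrier (Homeo0_group A)" using assms(16) by (simp add: Homeo0_group_def)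
    fix \<Gamma> assume \<Gamma>: "subgroup \<Gamma> (Homeo0_group A) \<and> f \<in> \<Gamma> \<and> (\<exists>S. finite_generating_set (Homeo0_group A\<lparr>carrier := \<Gamma>\<rparr>) S)"
    let ?H = "Homeo0_group A\<lparr>carrier := \<Gamma>\<rparr>"
    interpret H0: group "Homeo0_group A" by (rule group_Homeo0)
    interpret \<Gamma>: group ?H using \<Gamma> by (intro H0.subgroup_imp_group) simp
    have sub: "\<Gamma> \<subseteq> Homeo0 A"
      using \<Gamma> subgroup.subset by (fastforce simp: Homeo0_group_def)
    have mult: "mult ?H = (\<circ>)" "one ?H = id" by (simp_all add: Homeo0_group_def)
    have pow: "f [^]\<^bsub>?H\<^esub> k = f ^^ k" for k :: nat
    proof (induction k)
      case (Suc k)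
      \<comment> \<open>Group powers multiply on the right, whereas \<open>^^\<close> unfolds on the
        left.\<close>
      then show ?case by (simp add: mult funpow_Suc_right del: funpow.simps)
    qed (simp add: mult)
    show "undistorted_fg ?H f"
    proof (rule \<Gamma>.undistorted_fgI)
      show "f \<in> carrier ?H" using \<Gamma> by simp
      show "0 < a" using assms(19) by (simp add: a_def)
      fix S assume S: "finite_generating_set ?H S"
      let ?T = "S \<union> m_inv ?H ` S"
      have T: "finite ?T" "?T \<subseteq> Homeo0 A"
        using S sub \<Gamma>.inv_closed by (auto simp: finite_generating_set_def)
      have "\<forall>w\<in>?T. \<exists>J. isotopy_from_id A J w \<and> (\<exists>C. \<forall>x\<in>?S. \<bar>twisted \<tau> (\<lambda>t. conf_flow J (t, x))\<bar> \<le> C)"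
        using gen subsetD[OF T(2)] by blast
      from bchoice[OF this] obtain J where J': "\<forall>w\<in>?T. isotopy_from_id A (J w) w \<and>
          (\<exists>C. \<forall>x\<in>?S. \<bar>twisted \<tau> (\<lambda>t. conf_flow (J w) (t, x))\<bar> \<le> C)" ..
      then have J: "isotopy_from_id A (J w) w" if "w \<in> ?T" for w using that by blast
      have "\<forall>w\<in>?T. \<exists>C. \<forall>x\<in>?S. \<bar>twisted \<tau> (\<lambda>t. conf_flow (J w) (t, x))\<bar> \<le> C"
        using J' by blast
      from bchoice[OF this] obtain C where
        C: "\<forall>w\<in>?T. \<forall>x\<in>?S. \<bar>twisted \<tau> (\<lambda>t. conf_flow (J w) (t, x))\<bar> \<le> C w" ..
      \<comment> \<open>The inserted 0 keeps \<open>Max\<close> meaningful for an empty generating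
        set and gives \<open>0 \<le> M\<close>.\<close>
      define M where "M = Max (insert 0 (C ` ?T))"
      have M: "0 \<le> M" "\<And>w. w \<in> ?T \<Longrightarrow> C w \<le> M" using T(1) by (auto simp: M_def)
      have bd_M: "\<bar>twisted \<tau> (\<lambda>t. conf_flow (J w) (t, x))\<bar> \<le> M" if "w \<in> ?T" "x \<in> ?S" for w x
        using bspec[OF bspec[OF C that(1)] that(2)] M(2)[OF that(1)] by simp
      \<comment> \<open>The 1 in the factor ensures that it is strictly positive, as the criterion
        demands; the subtracted \<open>Df\<close> comes from comparing isotopies in
        \<open>power_bound\<close>.\<close>
      have "real k * a - Df \<le> (M + Df + 1) * real (length ws)"
        if ws: "set ws \<subseteq> ?T" "foldr (mult ?H) ws (one ?H) = f [^]\<^bsub>?H\<^esub> k" for k :: nat and ws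
      proof -
        obtain L where L: "isotopy_from_id A L (foldr (\<circ>) ws id)"
          and bd: "\<forall>x\<in>?S. \<bar>twisted \<tau> (\<lambda>t. conf_flow L (t, x))\<bar> \<le> real (length ws) * (M + Df)"
          using twisted_word_bound[OF quasimorphism_functor_axioms \<tau> M(1) J bd_M ws(1)] by blast
        have "isotopy_from_id A L (f ^^ k)" using L ws(2) by (simp add: mult pow)
        then have "\<bar>real k * a\<bar> \<le> real (length ws) * (M + Df) + Df"
          using power_bound[of L k] bspec[OF bd zS] by simp
        then show ?thesis by (simp add: algebra_simps)
      qed
      then show "\<exists>b c. 0 < c \<and> (\<forall>k ws. set ws \<subseteq> ?T \<longrightarrow> foldr (mult ?H) ws (one ?H) = f [^]\<^bsub>?H\<^esub> (k::nat) \<longrightarrow>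
          real k * a - b \<le> c * real (length ws))"
        using M(1) defect_nonneg by (intro exI[of _ Df] exI[of _ "M + Df + 1"]) auto
    qed
  qed
qed

end
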